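(* Let $f$ be a real-valued objective function on an input space $\mathcal{X}\subset\mathbb{R}^n$, modeled by a Gaussian process with prior mean $\mu_0$ and kernel (covariance) function $\kappa$. Let $\boldsymbol{x}_1,\dots,\boldsymbol{x}_k\in\mathcal{X}$ be the points at which $f$ has been observed. Write $f(\boldsymbol{x}_{1:k})=(f(\boldsymbol{x}_1),\dots,f(\boldsymbol{x}_k))^{\mathrm T}$ and $\mu_0(\boldsymbol{x}_{1:k})=(\mu_0(\boldsymbol{x}_1),\dots,\mu_0(\boldsymbol{x}_k))^{\mathrm T}$ (the initial mean of the first $k$ samples), and let $\mathbf{K}_{\boldsymbol{x}_{1:k},\boldsymbol{x}_{1:k}}$ be the $k\times k$ covariance matrix with entries $\kappa(\boldsymbol{x}_i,\boldsymbol{x}_j)$, with inverse $\mathbf{K}^{-1}_{\boldsymbol{x}_{1:k},\boldsymbol{x}_{1:k}}$. Let $\boldsymbol{x}_{k+1},\boldsymbol{y}_{k+1}\in\mathcal{X}$ be two (possibly different) points, and let the joint Gaussian posterior of the objective value at $\boldsymbol{x}_{k+1}$ and its first-order derivative (gradient) at $\boldsymbol{y}_{k+1}$ be $$\begin{bmatrix} f(\boldsymbol{x}_{k+1})\\ f'(\boldsymbol{y}_{k+1})\end{bmatrix}\Big|\,f(\boldsymbol{x}_{1:k})\ \sim\ \mathcal{N}\left(\begin{bmatrix}\mu_{\boldsymbol{x}_{k+1}}\\ \mu_{\boldsymbol{y}_{k+1}}\end{bmatrix},\begin{bmatrix}\Sigma_{\boldsymbol{x}_{k+1},\boldsymbol{x}_{k+1}}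 & \Sigma_{\boldsymbol{x}_{k+1},\boldsymbol{y}_{k+1}}\\ \Sigma_{\boldsymbol{y}_{k+1},\boldsymbol{x}_{k+1}} & \Sigma_{\boldsymbol{y}_{k+1},\boldsymbol{y}_{k+1}}\end{bmatrix}\right).$$ Under the interchangeable condition (see context), the mean of this joint Gaussian posterior is $$\mu_{k+1}:=\begin{bmatrix}\mu_{\boldsymbol{x}_{k+1}}\\ \mu_{\boldsymbol{y}_{k+1}}\end{bmatrix}=\mathbf{A}\,\mathbf{K}^{-1}_{\boldsymbol{x}_{1:k},\boldsymbol{x}_{1:k}}\bigl(f(\boldsymbol{x}_{1:k})-\mu_0(\boldsymbol{x}_{1:k})\bigr),$$ where $$\mathbf{A}=\begin{bmatrix}\kappa(\boldsymbol{x}_{k+1},\boldsymbol{x}_{1:k})\\ \frac{d}{d\boldsymbol{y}_{k+1}}\kappa(\boldsymbol{y}_{k+1},\boldsymbol{x}_{1:k})\end{bmatrix}.$$ Additionally, the variance of this posterior is $$\sigma^2_{k+1}:=\begin{bmatrix}\Sigma_{\boldsymbol{x}_{k+1},\boldsymbol{x}_{k+1}} & \Sigma_{\boldsymbol{x}_{k+1},\boldsymbol{y}_{k+1}}\\ \Sigma_{\boldsymbol{y}_{k+1},\boldsymbol{x}_{k+1}} & \Sigma_{\boldsymbol{y}_{k+1},\boldsymbol{y}_{k+1}}\end{bmatrix}=\mathbf{K}_0-\mathbf{A}\,\mathbf{K}^{-1}_{\boldsymbol{x}_{1:k},\boldsymbol{x}_{1:k}}\mathbf{A}^{\mathrm T},$$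 where $$\mathbf{K}_0=\begin{bmatrix}\kappa(\boldsymbol{x}_{k+1},\boldsymbol{x}_{k+1}) & \frac{d}{d\boldsymbol{y}_{k+1}}\kappa(\boldsymbol{x}_{k+1},\boldsymbol{y}_{k+1})\\ \frac{d}{d\boldsymbol{y}_{k+1}}\kappa(\boldsymbol{y}_{k+1},\boldsymbol{x}_{k+1}) & \frac{d^2}{d\boldsymbol{y}_{k+1}\,d\boldsymbol{y}_{k+1}}\kappa(\boldsymbol{y}_{k+1},\boldsymbol{y}_{k+1})\end{bmatrix}.$$
   Context: Interchangeable condition (for a function $g$ and a random variable $Y$): $Y\in\mathcal{Y}$ is a random variable and $g:\mathbb{R}\times\mathcal{Y}\to\mathbb{R}$ is a function such that $g(t,Y)$ is integrable for all $t$ and $g$ is continuously differentiable with respect to $t$; and there is a random variable $Z$ with $\mathbb{E}(Z)<\infty$ such that $|\frac{\partial}{\partial t}g(t,Y)|\le Z$ almost surely for all $t$. It is the condition under which $\frac{\partial}{\partial t}\mathbb{E}[g(t,Y)]=\mathbb{E}[\frac{\partial}{\partial t}g(t,Y)]$. In the theorem it is what allows the derivative with respect to $\boldsymbol{y}_{k+1}$ to be interchanged with the expectation of $f(\boldsymbol{y}_{k+1})$ given $f(\boldsymbol{x}_{1:k})$. Notation: $f'$ is the first-order derivative (gradient, a vector in $\mathbb{R}^n$) of $f$; the derivative of a Gaussian process is again treated as a Gaussian process. $\kappa(\boldsymbol{x}_{k+1},\boldsymbol{x}_{1:k})$ is the row $(\kappa(\boldsymbol{x}_{k+1},\boldsymbol{x}_1),\dots,\kappa(\boldsymbol{x}_{k+1},\boldsymbol{x}_k))$,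 and $\frac{d}{d\boldsymbol{y}_{k+1}}\kappa(\boldsymbol{y}_{k+1},\boldsymbol{x}_{1:k})$ is the $n\times k$ matrix whose $j$-th column is the gradient of $\kappa(\cdot,\boldsymbol{x}_j)$ at $\boldsymbol{y}_{k+1}$. In $\mathbf{K}_0$ the derivatives act on the argument slot(s) occupied by $\boldsymbol{y}_{k+1}$: the upper right entry is the gradient in the second argument, written as a row; the lower left entry is the gradient in the first argument, written as a column; and the lower right entry is the $n\times n$ matrix of mixed second derivatives, one in the first argument and one in the second, evaluated at $(\boldsymbol{y}_{k+1},\boldsymbol{y}_{k+1})$. Observations are the values $f(\boldsymbol{x}_{1:k})$ themselves, with no noise term.
   Formalization: The printed mean omits the prior mean; the formal one adds [μ0(x_{k+1}); ∇μ0(y_{k+1})] to A K^{-1}(f−μ0), and gives the printed formula when that vector is zero. y_{k+1} is taken in the interior of X so that the gradient is defined. *)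

theory Defs
  imports "HOL-Probability.Probability"
begin

(* Variance 0 is allowed and means a point mass: conditioning on noise-free observations
   produces singular covariance matrices (for example when the new point was already observed). *)
definition normal_law :: "real \<Rightarrow> real \<Rightarrow> real measure" where
  "normal_law m v =
     (if v = 0 then return borel m else density lborel (normal_density m (sqrt v)))"

(* All finite-dimensional marginals of Y are Gaussian with mean m and covariance C.
   A random vector is N(m, C) iff every linear combination c of its coordinates has law
   N(c m, c C c). *)
definition gaussian_family ::
    "'w measure \<Rightarrow> 'i set \<Rightarrow> ('i \<Rightarrow> 'w \<Rightarrow> real) \<Rightarrow> ('i \<Rightarrow> real) \<Rightarrow> ('i \<Rightarrow> 'i \<Rightarrow> real) \<Rightarrow> bool" where
  "gaussian_family M I Y m C \<longleftrightarrow>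
     prob_space M \<and>
     (\<forall>i\<in>I. Y i \<in> borel_measurable M) \<and>
     (\<forall>i\<in>I. \<forall>j\<in>I. C i j = C j i) \<and>
     (\<forall>J c. finite J \<and> J \<subseteq> I \<longrightarrow>
        0 \<le> (\<Sum>i\<in>J. \<Sum>j\<in>J. c i * c j * C i j) \<and>
        distr M borel (\<lambda>w. \<Sum>i\<in>J. c i * Y i w) =
          normal_law (\<Sum>i\<in>J. c i * m i) (\<Sum>i\<in>J. \<Sum>j\<in>J. c i * c j * C i j))"

definition gaussian_process ::
    "'w measure \<Rightarrow> (real^'n) set \<Rightarrow> (real^'n \<Rightarrow> 'w \<Rightarrow> real) \<Rightarrow> (real^'n \<Rightarrow> real) \<Rightarrow>
     (real^'n \<Rightarrow> real^'n \<Rightarrow> real) \<Rightarrow> bool" where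
  "gaussian_process M X f \<mu>0 \<kappa> \<longleftrightarrow> gaussian_family M X f \<mu>0 \<kappa>"

definition multivariate_normal :: "(real^'d) measure \<Rightarrow> real^'d \<Rightarrow> real^'d^'d \<Rightarrow> bool" where
  "multivariate_normal N m S \<longleftrightarrow>
     sets N = sets borel \<and>
     gaussian_family N UNIV (\<lambda>i v. v $ i) (\<lambda>i. m $ i) (\<lambda>i j. S $ i $ j)"

definition regular_conditional_distribution ::
    "'w measure \<Rightarrow> ('w \<Rightarrow> 'b::topological_space) \<Rightarrow> ('w \<Rightarrow> 'c::topological_space) \<Rightarrow>
     ('b \<Rightarrow> 'c measure) \<Rightarrow> bool" where
  "regular_conditional_distribution M V U Q \<longleftrightarrow>
     Q \<in> borel \<rightarrow>\<^sub>M prob_algebra borel \<and>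
     (\<forall>B\<in>sets borel. AE w in M.
        real_cond_exp M (vimage_algebra (space M) V borel) (indicator (U -` B)) w
          = measure (Q (V w)) B)"

(* U | V ~ N(m V, S V).  Conditional laws are determined only almost surely. *)
definition gaussian_posterior ::
    "'w measure \<Rightarrow> ('w \<Rightarrow> 'b::topological_space) \<Rightarrow> ('w \<Rightarrow> real^'d) \<Rightarrow>
     ('b \<Rightarrow> real^'d) \<Rightarrow> ('b \<Rightarrow> real^'d^'d) \<Rightarrow> bool" where
  "gaussian_posterior M V U m S \<longleftrightarrow>
     (\<exists>Q. regular_conditional_distribution M V U Q \<and>
          (AE w in M. multivariate_normal (Q (V w)) (m (V w)) (S (V w))))"

(* The parameter t is restricted to T because a process on a subset of R^n cannot be moved
   along a whole line; the random variable Y is the identity on the space of P. *)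
definition interchangeable_on :: "real set \<Rightarrow> 'y measure \<Rightarrow> (real \<Rightarrow> 'y \<Rightarrow> real) \<Rightarrow> bool" where
  "interchangeable_on T P g \<longleftrightarrow>
     (\<forall>t\<in>T. integrable P (g t)) \<and>
     (\<forall>y\<in>space P. (\<lambda>t. g t y) C1_differentiable_on T) \<and>
     (\<exists>Z. integrable P Z \<and> (\<forall>t\<in>T. AE y in P. \<bar>deriv (\<lambda>s. g s y) t\<bar> \<le> Z y))"

definition gradient :: "(real^'n \<Rightarrow> real) \<Rightarrow> real^'n \<Rightarrow> real^'n" where
  "gradient h y = (\<chi> i. deriv (\<lambda>t. h (y + t *\<^sub>R axis i 1)) 0)"

definition at_points :: "('k \<Rightarrow> real^'n) \<Rightarrow> (real^'n \<Rightarrow> real) \<Rightarrow> real^'k" where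
  "at_points x h = (\<chi> j. h (x j))"

definition kernel_matrix ::
    "(real^'n \<Rightarrow> real^'n \<Rightarrow> real) \<Rightarrow> ('k \<Rightarrow> real^'n) \<Rightarrow> real^'k^'k" where
  "kernel_matrix \<kappa> x = (\<chi> i j. \<kappa> (x i) (x j))"

(* The (1 + n)-dimensional vectors and matrices are indexed by unit + 'n: the index Inl ()
   belongs to the value at p, the index Inr i to the i-th partial derivative at y.
   Applied to a sample path this is the predicted vector, applied to the prior mean function
   it is the mean of that vector before conditioning. *)
definition value_and_gradient ::
    "(real^'n \<Rightarrow> real) \<Rightarrow> real^'n \<Rightarrow> real^'n \<Rightarrow> real^(unit + 'n)" where
  "value_and_gradient h p y =
     (\<chi> r. case r of Inl _ \<Rightarrow> h p | Inr i \<Rightarrow> gradient h y $ i)"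

definition cross_covariance ::
    "(real^'n \<Rightarrow> real^'n \<Rightarrow> real) \<Rightarrow> ('k \<Rightarrow> real^'n) \<Rightarrow> real^'n \<Rightarrow> real^'n \<Rightarrow>
     real^'k^(unit + 'n)" where
  "cross_covariance \<kappa> x p y =
     (\<chi> r j. case r of
        Inl _ \<Rightarrow> \<kappa> p (x j)
      | Inr i \<Rightarrow> gradient (\<lambda>u. \<kappa> u (x j)) y $ i)"

(* Each derivative acts on the argument slot occupied by y: rows differentiate the first
   argument of the kernel, columns the second. *)
definition prior_covariance ::
    "(real^'n \<Rightarrow> real^'n \<Rightarrow> real) \<Rightarrow> real^'n \<Rightarrow> real^'n \<Rightarrow>
     real^(unit + 'n)^(unit + 'n)" where
  "prior_covariance \<kappa> p y =
     (\<chi> r s. case r of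
        Inl _ \<Rightarrow> (case s of
            Inl _ \<Rightarrow> \<kappa> p p
          | Inr j \<Rightarrow> gradient (\<lambda>v. \<kappa> p v) y $ j)
      | Inr i \<Rightarrow> (case s of
            Inl _ \<Rightarrow> gradient (\<lambda>u. \<kappa> u p) y $ i
          | Inr j \<Rightarrow> gradient (\<lambda>u. gradient (\<lambda>v. \<kappa> u v) y $ j) y $ i))"

end

theory Submission
  imports Defs
begin

text \<open>Pointwise limits of Gaussian random variables are Gaussian, with convergent means and
  variances, so the affine combinations of the process values together with their pointwise limits
  form a linear space of Gaussian variables on which expectation and covariance are sequentially
  continuous. The partial derivatives of the sample paths are limits of difference quotients, hence
  belong to this space, and continuity of the covariance identifies their moments with derivatives
  of the prior mean and kernel. With \<open>B = A ** matrix_inv K\<close> the residual of the predicted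
  vector after subtracting \<open>B (fx - E fx)\<close> is uncorrelated with the observations, hence independent of
  them, and the posterior is the law of the residual shifted by a function of the observations.
  Independence comes from the uniqueness of characteristic functions in several dimensions, which
  follows from the Stone--Weierstrass theorem for trigonometric polynomials.\<close>

section \<open>Characteristic functions on Euclidean spaces\<close>

text \<open>The gradient of a sample path is not a finite linear combination of process values, and
  the hypotheses speak of the law of the process only; joint normality of values and partial
  derivatives has to come out of the limit. A vector space of random variables all of whose members
  are normal reduces this to the real line: every linear form in the coordinates is again a member,
  so only laws on the line must be followed through limits. There the parameters are forced to
  converge together with the laws, and this carries expectations and variances to the limit where
  pointwise convergence by itself would not. Degenerate normal laws are kept throughout, since a
  difference quotient or a residual may be almost surely constant. The posterior so constructed is
  one version among many, so a comparison of versions, reduced to countably many events, transfers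
  its moments to every other posterior.\<close>

inductive_set trig_functions :: "('a::euclidean_space \<Rightarrow> real) set" where
  cos: "(\<lambda>x. cos (t \<bullet> x)) \<in> trig_functions"
| sin: "(\<lambda>x. sin (t \<bullet> x)) \<in> trig_functions"
| add: "\<lbrakk>g \<in> trig_functions; h \<in> trig_functions\<rbrakk> \<Longrightarrow> (\<lambda>x. g x + h x) \<in> trig_functions"
| scale: "g \<in> trig_functions \<Longrightarrow> (\<lambda>x. c * g x) \<in> trig_functions"

lemma trig_const: "(\<lambda>x::'a::euclidean_space. c) \<in> trig_functions"
  using trig_functions.scale[OF trig_functions.cos[of "0::'a"], of c] by simp

text \<open>Product-to-sum identities turn products of generators into linear combinations of
  generators. This is what makes the real span of \<open>cos\<close> and \<open>sin\<close> an
  algebra although products are absent from the inductive rules.\<close>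

lemma trig_cos_mult:
  assumes "h \<in> trig_functions"
  shows "(\<lambda>x. cos (t \<bullet> x) * h x) \<in> trig_functions"
  using assms
proof induction
  case (cos s)
  have "(\<lambda>x. (1/2) * cos ((t - s) \<bullet> x) + (1/2) * cos ((t + s) \<bullet> x)) \<in> trig_functions"
    by (intro trig_functions.intros)
  then show ?case by (simp add: cos_times_cos inner_diff_left inner_add_left add_divide_distrib)
next
  case (sin s)
  have "(\<lambda>x. (1/2) * sin ((t + s) \<bullet> x) + (-1/2) * sin ((t - s) \<bullet> x)) \<in> trig_functions"
    by (intro trig_functions.intros)
  then show ?case by (simp add: cos_times_sin inner_diff_left inner_add_left diff_divide_distrib)
next
  case (add g h)
  then show ?case using trig_functions.add by (simp add: distrib_left)
next
  case (scale g c)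
  then show ?case using trig_functions.scale[of _ c] by (simp add: mult.left_commute)
qed

lemma trig_sin_mult:
  assumes "h \<in> trig_functions"
  shows "(\<lambda>x. sin (t \<bullet> x) * h x) \<in> trig_functions"
  using assms
proof induction
  case (cos s)
  then show ?case
    using trig_cos_mult[OF trig_functions.sin[of t], of s] by (simp add: mult.commute)
next
  case (sin s)
  have "(\<lambda>x. (1/2) * cos ((t - s) \<bullet> x) + (-1/2) * cos ((t + s) \<bullet> x)) \<in> trig_functions"
    by (intro trig_functions.intros)
  then show ?case by (simp add: sin_times_sin inner_diff_left inner_add_left diff_divide_distrib)
next
  case (add g h)
  then show ?case using trig_functions.add by (simp add: distrib_left)
next
  case (scale g c)
  then show ?case using trig_functions.scale[of _ c] by (simp add: mult.left_commute)
qed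

lemma trig_mult:
  assumes "g \<in> trig_functions" "h \<in> trig_functions"
  shows "(\<lambda>x. g x * h x) \<in> trig_functions"
  using assms(1)
proof induction
  case (add g1 g2)
  then show ?case using trig_functions.add by (simp add: distrib_right)
next
  case (scale g c)
  then show ?case using trig_functions.scale[of _ c] by (simp add: mult.assoc)
qed (use assms(2) trig_cos_mult trig_sin_mult in auto)

text \<open>A polynomial function is assembled from linear maps, constants, sums and products, and
  the algebra is closed under these. It serves to imitate a truncation inside the algebra.\<close>

lemma trig_polynomial:
  fixes q :: "real \<Rightarrow> real"
  assumes "real_polynomial_function q" "g \<in> trig_functions"
  shows "(\<lambda>x. q (g x)) \<in> trig_functions"
  using assms(1)
proof induction
  case (linear f)
  then obtain c where "f = (\<lambda>x. x * c)" using real_bounded_linear by auto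
  then show ?case using trig_functions.scale[OF assms(2), of c] by (simp add: mult.commute)
next
  case (const c)
  then show ?case by (rule trig_const)
qed (auto intro: trig_mult trig_functions.add)

lemma trig_continuous: "g \<in> trig_functions \<Longrightarrow> continuous_on S g"
  by (induction rule: trig_functions.induct) (auto intro!: continuous_intros)

lemma trig_bounded: "g \<in> trig_functions \<Longrightarrow> \<exists>B. \<forall>x. \<bar>g x\<bar> \<le> B"
proof (induction rule: trig_functions.induct)
  case (add g h)
  then obtain B C where "\<forall>x. \<bar>g x\<bar> \<le> B" "\<forall>x. \<bar>h x\<bar> \<le> C" by auto
  then have "\<forall>x. \<bar>g x + h x\<bar> \<le> B + C" by (meson abs_triangle_ineq add_mono order_trans)
  then show ?case by blast
next
  case (scale g c)
  then obtain B where "\<forall>x. \<bar>g x\<bar> \<le> B" by auto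
  then have "\<forall>x. \<bar>c * g x\<bar> \<le> \<bar>c\<bar> * B" by (simp add: abs_mult mult_left_mono)
  then show ?case by blast
qed (auto intro: exI[of _ 1])

lemma trig_separates:
  fixes x y :: "'a::euclidean_space"
  assumes "x \<noteq> y"
  shows "\<exists>g\<in>trig_functions. g x \<noteq> g y"
proof (rule ccontr)
  define d where "d = x - y"
  \<comment> \<open>Scaled so that \<open>t \<bullet> x - t \<bullet> y\<close> is
    \<open>pi\<close>: the cosine of the difference is then -1, whereas equal sines and cosines
    would force it to be 1.\<close>
  define t where "t = (pi / (d \<bullet> d)) *\<^sub>R d"
  have d: "d \<bullet> d \<noteq> 0" using assms by (simp add: d_def)
  assume "\<not> ?thesis"
  then have c: "cos (t \<bullet> x) = cos (t \<bullet> y)" and s: "sin (t \<bullet> x) = sin (t \<bullet> y)"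
    using bspec[OF _ trig_functions.cos[of t], of "\<lambda>g. g x = g y"]
      bspec[OF _ trig_functions.sin[of t], of "\<lambda>g. g x = g y"] by simp_all
  have "cos (t \<bullet> x - t \<bullet> y) = 1"
    using sin_cos_squared_add[of "t \<bullet> y"] by (simp add: cos_diff c s power2_eq_square)
  moreover have "t \<bullet> x - t \<bullet> y = pi"
    unfolding inner_diff_right[symmetric] d_def[symmetric] using d by (simp add: t_def)
  ultimately show False by simp
qed

text \<open>A trigonometric polynomial close to \<^term>\<open>g\<close> on the compact set \<^term>\<open>S\<close> may be large
  elsewhere; composing it with a polynomial close to a truncation keeps it bounded.\<close>
lemma trig_approximation:
  fixes g :: "'a::euclidean_space \<Rightarrow> real"
  assumes S: "compact S" and g: "continuous_on S g" "\<And>x. \<bar>g x\<bar> \<le> 1" and e: "0 < e"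
  obtains h where "h \<in> trig_functions" "\<And>x. x \<in> S \<Longrightarrow> \<bar>g x - h x\<bar> < e" "\<And>x. \<bar>h x\<bar> \<le> 1 + e"
proof -
  interpret function_ring_on "trig_functions :: ('a \<Rightarrow> real) set" S
    by unfold_locales
      (auto intro: S trig_continuous trig_functions.add trig_mult trig_const dest: trig_separates)
  obtain h0 where h0: "h0 \<in> trig_functions" "\<And>x. x \<in> S \<Longrightarrow> \<bar>g x - h0 x\<bar> < e / 2"
    using Stone_Weierstrass_basic[OF g(1), of "e/2"] e by auto
  obtain B where B: "\<And>x. \<bar>h0 x\<bar> \<le> B" using trig_bounded[OF h0(1)] by auto
  \<comment> \<open>\<open>clamp\<close> is 1-Lipschitz and fixes the values of \<open>g\<close>,
    which lie between -1 and 1, so truncating \<open>h0\<close> costs nothing on \<open>S\<close>.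
    The polynomial \<open>q\<close> has to imitate it only on \<open>{-B..B}\<close>, which contains
    the range of \<open>h0\<close>.\<close>
  define clamp :: "real \<Rightarrow> real" where "clamp s = max (-1) (min 1 s)" for s
  have "continuous_on {-B..B} clamp" unfolding clamp_def by (intro continuous_intros)
  then obtain q :: "real \<Rightarrow> real" where q: "real_polynomial_function q" "\<And>s. s \<in> {-B..B} \<Longrightarrow> \<bar>clamp s - q s\<bar> < e / 2"
    using Stone_Weierstrass_real_polynomial_function[of "{-B..B}" clamp "e/2"] e by auto
  have qh: "\<bar>clamp (h0 x) - q (h0 x)\<bar> < e / 2" for x
    using q(2)[of "h0 x"] B[of x] by (auto simp: abs_le_iff)
  show ?thesis
  proof
    show "(\<lambda>x. q (h0 x)) \<in> trig_functions" using q h0 by (simp add: trig_polynomial)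
    show "\<bar>g x - q (h0 x)\<bar> < e" if "x \<in> S" for x
      using qh[of x] h0(2)[OF that] g(2)[of x] unfolding clamp_def min_def max_def abs_less_iff abs_le_iff
      by (smt (verit) field_sum_of_halves)
    show "\<bar>q (h0 x)\<bar> \<le> 1 + e" for x
      using qh[of x] e unfolding clamp_def min_def max_def by (smt (verit) field_sum_of_halves)
  qed
qed

lemma measurable_trig: "g \<in> trig_functions \<Longrightarrow> g \<in> borel_measurable borel"
  using trig_continuous[of g UNIV] borel_measurable_continuous_onI by auto

lemma integrable_trig:
  assumes "finite_measure M" "sets M = sets borel" "g \<in> trig_functions"
  shows "integrable M g"
proof -
  interpret finite_measure M by fact
  obtain B where "\<And>x. \<bar>g x\<bar> \<le> B" using trig_bounded[OF assms(3)] by auto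
  then show ?thesis
    using measurable_trig[OF assms(3)] measurable_cong_sets[OF assms(2) refl]
    by (intro integrable_const_bound[of _ B]) auto
qed

lemma trig_integral_eq:
  fixes M N :: "'a::euclidean_space measure"
  assumes M: "prob_space M" "sets M = sets borel" and N: "prob_space N" "sets N = sets borel"
    and char: "\<And>t. (\<integral>x. iexp (t \<bullet> x) \<partial>M) = (\<integral>x. iexp (t \<bullet> x) \<partial>N)"
    and g: "g \<in> trig_functions"
  shows "integral\<^sup>L M g = integral\<^sup>L N g"
  using g
proof induction
  interpret M: prob_space M by fact
  interpret N: prob_space N by fact
  note [measurable_cong] = M(2) N(2)
  have i: "integrable M (\<lambda>x. iexp (t \<bullet> x))" "integrable N (\<lambda>x. iexp (t \<bullet> x))" for t
    by (auto intro!: M.integrable_const_bound[of _ 1] N.integrable_const_bound[of _ 1])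
  {
    case (cos t)
    show ?case using arg_cong[OF char[of t], of Re] i[of t] by (simp add: integral_Re[symmetric] Re_exp)
  next
    case (sin t)
    show ?case using arg_cong[OF char[of t], of Im] i[of t] by (simp add: integral_Im[symmetric] Im_exp)
  next
    case (add g h)
    then show ?case using integrable_trig[OF M.finite_measure_axioms M(2)] integrable_trig[OF N.finite_measure_axioms N(2)] by simp
  next
    case (scale g c)
    then show ?case by simp
  }
qed


section \<open>Equality of laws from equality of characteristic functions\<close>

text \<open>Tightness of a single law. The form with \<open>eventually\<close> lets one radius serve
  two measures at once.\<close>

lemma prob_cball_almost_full:
  fixes M :: "'a::euclidean_space measure"
  assumes "prob_space M" "sets M = sets borel" "0 < e"
  shows "eventually (\<lambda>n. 1 - e < measure M (cball 0 (real n))) sequentially"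
proof -
  interpret prob_space M by fact
  have sp: "space M = UNIV" using sets_eq_imp_space_eq[OF assms(2)] by simp
  have "(\<lambda>n. measure M (cball 0 (real n))) \<longlonglongrightarrow> measure M (\<Union>n. cball 0 (real n))"
    by (intro finite_Lim_measure_incseq) (auto simp: assms incseq_def)
  moreover have "(\<Union>n. cball (0::'a) (real n)) = space M" using real_arch_simple by (auto simp: sp)
  ultimately have "(\<lambda>n. measure M (cball 0 (real n))) \<longlonglongrightarrow> 1" by (simp add: prob_space)
  then show ?thesis using assms(3) by (intro order_tendstoD) auto
qed

lemma continuous_integral_eq:
  fixes M N :: "'a::euclidean_space measure"
  assumes M: "prob_space M" "sets M = sets borel" and N: "prob_space N" "sets N = sets borel"
    and char: "\<And>t. (\<integral>x. iexp (t \<bullet> x) \<partial>M) = (\<integral>x. iexp (t \<bullet> x) \<partial>N)"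
    and g: "continuous_on UNIV g" "\<And>x. \<bar>g x\<bar> \<le> 1"
  shows "integral\<^sup>L M g = (integral\<^sup>L N g :: real)"
proof (rule ccontr)
  assume ne: "integral\<^sup>L M g \<noteq> integral\<^sup>L N g"
  \<comment> \<open>Replacing \<open>g\<close> by \<open>h\<close> moves each of the two integrals
    by at most \<open>4 * e\<close>: \<open>e\<close> from the ball and \<open>3 * e\<close> from
    its complement, where the functions differ by at most \<open>2 + e\<close>, and the cap at 1
    makes this at most 3. The total \<open>8 * e\<close> stays below \<open>10 * e\<close>.\<close>
  define e where "e = min 1 (\<bar>integral\<^sup>L M g - integral\<^sup>L N g\<bar> / 10)"
  have e: "0 < e" "e \<le> 1" "10 * e \<le> \<bar>integral\<^sup>L M g - integral\<^sup>L N g\<bar>"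
    using ne by (auto simp: e_def min_def)
  obtain n where n: "1 - e < measure M (cball 0 (real n))" "1 - e < measure N (cball 0 (real n))"
    using eventually_happens[OF eventually_conj[OF prob_cball_almost_full[OF M e(1)] prob_cball_almost_full[OF N e(1)]]]
    by auto
  define S where "S = cball (0::'a) (real n)"
  obtain h where h: "h \<in> trig_functions" "\<And>x. x \<in> S \<Longrightarrow> \<bar>g x - h x\<bar> < e" "\<And>x. \<bar>h x\<bar> \<le> 1 + e"
    using trig_approximation[of S g e] e(1) g continuous_on_subset[OF g(1)] unfolding S_def
    by (metis compact_cball subset_UNIV)
  have *: "\<bar>integral\<^sup>L P g - integral\<^sup>L P h\<bar> \<le> 4 * e"
    if P: "prob_space P" "sets P = sets borel" "1 - e < measure P S" for P
  proof -
    interpret prob_space P by fact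
    have sp: "space P = UNIV" using sets_eq_imp_space_eq[OF P(2)] by simp
    have S: "S \<in> sets P" by (simp add: P S_def)
    have gi: "integrable P g"
      using g borel_measurable_continuous_onI[OF g(1)] measurable_cong_sets[OF P(2) refl]
      by (intro integrable_const_bound[of _ 1]) auto
    have hi: "integrable P h" by (rule integrable_trig[OF finite_measure_axioms P(2) h(1)])
    have "\<bar>integral\<^sup>L P g - integral\<^sup>L P h\<bar> = \<bar>\<integral>x. g x - h x \<partial>P\<bar>" using gi hi by simp
    also have "\<dots> \<le> (\<integral>x. \<bar>g x - h x\<bar> \<partial>P)" by (rule integral_abs_bound)
    also have "\<dots> \<le> (\<integral>x. e + 3 * indicator (UNIV - S) x \<partial>P)"
    proof (rule integral_mono)
      show "integrable P (\<lambda>x. e + 3 * indicator (UNIV - S) x)"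
        using S e by (intro integrable_const_bound[of _ "e + 3"]) (auto simp: indicator_def)
      show "\<bar>g x - h x\<bar> \<le> e + 3 * indicator (UNIV - S) x" for x
        using h(2,3)[of x] g(2)[of x] e by (cases "x \<in> S") (auto simp: less_imp_le)
    qed (use gi hi in auto)
    also have "\<dots> = e + 3 * measure P (UNIV - S)"
    proof -
      have "integrable P (indicator (UNIV - S) :: 'a \<Rightarrow> real)"
        using S by (intro integrable_const_bound[of _ 1]) (auto simp: indicator_def)
      then show ?thesis using sets.compl_sets[OF S] by (simp add: sp prob_space[unfolded sp])
    qed
    also have "measure P (UNIV - S) = 1 - measure P S" using prob_compl[OF S] by (simp add: sp)
    finally show ?thesis using P(3) by simp
  qed
  show False
    using *[OF M n(1)[folded S_def]] *[OF N n(2)[folded S_def]] e trig_integral_eq[OF M N char h(1)] by linarith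
qed

text \<open>Closed sets generate the Borel sets and are stable under intersection. Off a closed set
  the distance is positive, so truncated multiples of the distance yield bounded continuous
  functions tending to its indicator.\<close>

theorem multivariate_char_unique:
  fixes M N :: "'a::euclidean_space measure"
  assumes M: "prob_space M" "sets M = sets borel" and N: "prob_space N" "sets N = sets borel"
    and char: "\<And>t. (\<integral>x. iexp (t \<bullet> x) \<partial>M) = (\<integral>x. iexp (t \<bullet> x) \<partial>N)"
  shows "M = N"
proof (rule measure_eqI_generator_eq[where E="Collect closed" and \<Omega>=UNIV and A="\<lambda>_. UNIV"])
  show "Int_stable (Collect closed :: 'a set set)" by (auto simp: Int_stable_def)
  show "sets M = sigma_sets UNIV (Collect closed)" "sets N = sigma_sets UNIV (Collect closed)"
    using M N by (simp_all add: borel_eq_closed)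
  interpret M: prob_space M by fact
  interpret N: prob_space N by fact
  show "emeasure M UNIV \<noteq> \<infinity>" by simp
  fix C :: "'a set" assume "C \<in> Collect closed"
  then have C: "closed C" by simp
  show "emeasure M C = emeasure N C"
  \<comment> \<open>\<open>infdist x {}\<close> is 0 by convention, so for empty \<open>C\<close>
    the functions \<open>h n\<close> would be constantly 1 instead of tending to the
    indicator.\<close>
  proof (cases "C = {}")
    case False
    define h :: "nat \<Rightarrow> 'a \<Rightarrow> real" where "h n x = max 0 (1 - real n * infdist x C)" for n x
    have hc: "continuous_on UNIV (h n)" for n unfolding h_def by (intro continuous_intros)
    have hb: "\<bar>h n x\<bar> \<le> 1" for n x unfolding h_def using infdist_nonneg[of x C] by auto
    have hl: "(\<lambda>n. h n x) \<longlonglongrightarrow> indicator C x" for x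
    proof (cases "x \<in> C")
      case True then show ?thesis by (simp add: h_def)
    next
      case x: False
      then have "infdist x C > 0" using in_closed_iff_infdist_zero[OF C False] infdist_nonneg[of x C] by (simp add: less_le)
      then obtain m :: nat where "1 / infdist x C < m" using reals_Archimedean2 by blast
      then have m: "1 < real m * infdist x C" using \<open>infdist x C > 0\<close> by (simp add: field_simps)
      have "h n x = 0" if "n \<ge> m" for n
      proof -
        have "real m * infdist x C \<le> real n * infdist x C" using that \<open>infdist x C > 0\<close> by simp
        then show ?thesis using m by (simp add: h_def)
      qed
      then have "eventually (\<lambda>n. h n x = 0) sequentially" by (auto simp: eventually_sequentially)
      then show ?thesis using x by (simp add: tendsto_eventually)
    qed
    have *: "(\<lambda>n. integral\<^sup>L P (h n)) \<longlonglongrightarrow> measure P C" if P: "prob_space P" "sets P = sets borel" for P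
    proof -
      interpret prob_space P by fact
      note [measurable_cong] = P(2)
      have [measurable]: "C \<in> sets borel" using C by simp
      have [measurable]: "h n \<in> borel_measurable borel" for n using borel_measurable_continuous_onI[OF hc] by simp
      have "(\<lambda>n. integral\<^sup>L P (h n)) \<longlonglongrightarrow> (\<integral>x. indicator C x \<partial>P)"
        by (rule integral_dominated_convergence[where w="\<lambda>_. 1"]) (auto simp: hl hb)
      then show ?thesis using sets_eq_imp_space_eq[OF P(2)] by simp
    qed
    have "(\<lambda>n. integral\<^sup>L N (h n)) \<longlonglongrightarrow> measure M C"
      using *[OF M] continuous_integral_eq[OF M N char hc hb] by simp
    then have "measure M C = measure N C" using *[OF N] LIMSEQ_unique by blast
    then show ?thesis by (simp add: M.emeasure_eq_measure N.emeasure_eq_measure)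
  qed simp
qed auto

section \<open>Normal laws on the line and their limits\<close>

text \<open>An affine image of the standard normal variable covers the point mass
  \<open>v = 0\<close> as well, so the characteristic function and the moments can be computed
  without a case distinction.\<close>

lemma normal_law_eq_distr:
  assumes "0 \<le> v"
  shows "normal_law m v = distr std_normal_distribution borel (\<lambda>x. m + sqrt v * x)"
proof (cases "v = 0")
  case True
  interpret real_distribution std_normal_distribution by (rule real_dist_normal_dist)
  show ?thesis using True by (simp add: normal_law_def)
next
  case False
  interpret real_distribution std_normal_distribution by (rule real_dist_normal_dist)
  have "distributed std_normal_distribution lborel (\<lambda>x. x) (normal_density 0 1)"
    by (auto simp: distributed_def distr_id2)
  from normal_density_affine[OF this, of "sqrt v" m] False assms
  have "distributed std_normal_distribution lborel (\<lambda>x. m + sqrt v * x) (normal_density m (sqrt v))"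
    by simp
  then have "distr std_normal_distribution lborel (\<lambda>x. m + sqrt v * x) = density lborel (normal_density m (sqrt v))"
    by (simp add: distributed_def)
  moreover have "distr std_normal_distribution lborel (\<lambda>x. m + sqrt v * x) = distr std_normal_distribution borel (\<lambda>x. m + sqrt v * x)"
    by (intro distr_cong) auto
  ultimately show ?thesis using False by (simp add: normal_law_def)
qed

lemma real_distribution_normal_law:
  assumes "0 \<le> v"
  shows "real_distribution (normal_law m v)"
  unfolding normal_law_eq_distr[OF assms]
  by (intro prob_space.real_distribution_distr real_distribution.axioms(1)[OF real_dist_normal_dist]) simp

lemma char_normal_law:
  assumes "0 \<le> v"
  shows "char (normal_law m v) t = iexp (t * m) * complex_of_real (exp (- v * t\<^sup>2 / 2))"
proof -
  have "char (normal_law m v) t = (\<integral>x. iexp (t * (m + sqrt v * x)) \<partial>std_normal_distribution)"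
    unfolding normal_law_eq_distr[OF assms] char_def by (subst integral_distr) auto
  also have "\<dots> = (\<integral>x. iexp (t * m) * iexp ((t * sqrt v) * x) \<partial>std_normal_distribution)"
    by (intro Bochner_Integration.integral_cong refl) (simp add: algebra_simps flip: exp_add)
  also have "\<dots> = iexp (t * m) * char std_normal_distribution (t * sqrt v)"
    by (simp add: char_def)
  also have "\<dots> = iexp (t * m) * complex_of_real (exp (- v * t\<^sup>2 / 2))"
    unfolding char_std_normal_distribution using assms by (simp add: power_mult_distrib mult.commute)
  finally show ?thesis .
qed

lemma normal_law_moments:
  assumes "0 \<le> v"
  shows "integrable (normal_law m v) (\<lambda>x. x\<^sup>2)"
    and "integrable (normal_law m v) (\<lambda>x. x)"
    and "(\<integral>x. x \<partial>normal_law m v) = m"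
    and "(\<integral>x. (x - m)\<^sup>2 \<partial>normal_law m v) = v"
proof -
  interpret real_distribution std_normal_distribution by (rule real_dist_normal_dist)
  have i [simp]: "integrable std_normal_distribution (\<lambda>x. x)" "integrable std_normal_distribution (\<lambda>x. x\<^sup>2)"
    using integrable_std_normal_distribution_moment[of 1] integrable_std_normal_distribution_moment[of 2] by simp_all
  have e [simp]: "(\<integral>x. x \<partial>std_normal_distribution) = 0" "(\<integral>x. x\<^sup>2 \<partial>std_normal_distribution) = 1"
    using integral_std_normal_distribution_moment_odd[of 1] std_normal_distribution_even_moments[of 1]
    by (simp_all add: has_bochner_integral_iff fact_2)
  show "integrable (normal_law m v) (\<lambda>x. x\<^sup>2)"
    unfolding normal_law_eq_distr[OF assms]
    by (subst integrable_distr_eq) (auto simp: power2_sum power_mult_distrib)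
  show "integrable (normal_law m v) (\<lambda>x. x)"
    unfolding normal_law_eq_distr[OF assms] by (subst integrable_distr_eq) auto
  show "(\<integral>x. x \<partial>normal_law m v) = m"
    unfolding normal_law_eq_distr[OF assms] by (subst integral_distr) (auto simp: prob_space[simplified])
  show "(\<integral>x. (x - m)\<^sup>2 \<partial>normal_law m v) = v"
    unfolding normal_law_eq_distr[OF assms] using assms
    by (subst integral_distr) (auto simp: power_mult_distrib)
qed

lemma normal_law_inject:
  assumes "0 \<le> v" "0 \<le> v'" "normal_law m v = normal_law m' v'"
  shows "m = m'" "v = v'"
proof -
  show m: "m = m'"
    using normal_law_moments(3)[OF assms(1), of m] normal_law_moments(3)[OF assms(2), of m']
    by (simp add: assms(3))
  show "v = v'"
    using normal_law_moments(4)[OF assms(1), of m, unfolded assms(3), unfolded m]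
      normal_law_moments(4)[OF assms(2), of m'] by simp
qed

text \<open>On an interval \<open>{0..a}\<close> where the limit has positive real part, the frequencies are recovered from
  \<open>m * (\<integral>t\<in>{0..a}. cos (t * m)) = sin (a * m)\<close>.\<close>
lemma frequencies_convergent:
  fixes m :: "nat \<Rightarrow> real" and \<psi> :: "real \<Rightarrow> complex"
  assumes conv: "\<And>t. (\<lambda>n. iexp (t * m n)) \<longlonglongrightarrow> \<psi> t" and cont: "isCont \<psi> 0"
  shows "convergent m"
proof -
  have \<psi>0: "\<psi> 0 = 1" by (rule LIMSEQ_unique[OF conv[of 0]]) simp
  have c: "(\<lambda>n. cos (t * m n)) \<longlonglongrightarrow> Re (\<psi> t)" and s: "(\<lambda>n. sin (t * m n)) \<longlonglongrightarrow> Im (\<psi> t)" for t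
    using tendsto_Re[OF conv[of t]] tendsto_Im[OF conv[of t]] by (simp_all add: Re_exp Im_exp)
  have "(\<lambda>t. Re (\<psi> t)) \<midarrow>0\<rightarrow> 1" using tendsto_Re[OF cont[unfolded isCont_def]] \<psi>0 by simp
  then have "eventually (\<lambda>t. 1/2 < Re (\<psi> t)) (at 0)" by (rule order_tendstoD) simp
  then obtain d where d: "d > 0" "\<And>t. t \<noteq> 0 \<Longrightarrow> \<bar>t\<bar> < d \<Longrightarrow> 1/2 < Re (\<psi> t)"
    unfolding eventually_at by (auto simp: dist_real_def)
  \<comment> \<open>Half of \<open>d\<close> keeps the closed interval \<open>{0..a}\<close> in the
    range where the real part exceeds 1/2. The bound survives integration, and the positive limit
    \<open>L\<close> of the \<open>I n\<close> permits division by them.\<close>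
  define a where "a = d / 2"
  have a: "a > 0" using d by (simp add: a_def)
  have a\<psi>: "1/2 \<le> Re (\<psi> t)" if "t \<in> {0..a}" for t
  proof (cases "t = 0")
    case False
    then have "\<bar>t\<bar> < d" using that d(1) by (auto simp: a_def)
    then show ?thesis using d(2)[OF False] by simp
  qed (simp add: \<psi>0)
  define I where "I n = (LBINT t:{0..a}. cos (t * m n))" for n
  define L where "L = (LBINT t:{0..a}. Re (\<psi> t))"
  have m1: "(\<lambda>t. Re (\<psi> t)) \<in> borel_measurable lborel"
    by (rule borel_measurable_LIMSEQ_real[OF c]) simp
  have IL: "I \<longlonglongrightarrow> L"
    unfolding I_def[abs_def] L_def set_lebesgue_integral_def
  proof (rule integral_dominated_convergence[where w="indicator {0..a}"])
    show "AE t in lborel. (\<lambda>n. indicator {0..a} t *\<^sub>R cos (t * m n)) \<longlonglongrightarrow> indicator {0..a} t *\<^sub>R Re (\<psi> t)"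
      by (intro AE_I2 tendsto_scaleR tendsto_const c)
  qed (use a m1 in \<open>auto simp: indicator_def\<close>)
  have "set_integrable lborel {0..a} (\<lambda>t. Re (\<psi> t))"
    unfolding set_integrable_def
  proof (rule Bochner_Integration.integrable_bound)
    have "\<bar>Re (\<psi> t)\<bar> \<le> 1" for t
      by (rule tendsto_upperbound[OF tendsto_rabs[OF c[of t]]]) auto
    then show "AE t in lborel. norm (indicator {0..a} t *\<^sub>R Re (\<psi> t)) \<le> norm (indicator {0..a} t :: real)"
      by (auto simp: indicator_def)
  qed (use m1 a in auto)
  then have "(LBINT t:{0..a}. 1/2) \<le> L"
    unfolding L_def using a a\<psi> by (intro set_integral_mono) (auto simp: set_integrable_def)
  then have L: "L > 0" using a by (simp add: set_lebesgue_integral_def)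
  have mI: "m n * I n = sin (a * m n)" for n
  proof -
    have "(LBINT t:{0..a}. m n * cos (t * m n)) = sin (a * m n) - sin (0 * m n)"
      unfolding set_lebesgue_integral_def using a
      by (subst integral_FTC_atLeastAtMost[where F="\<lambda>t. sin (t * m n)"])
        (auto intro!: derivative_eq_intros continuous_intros simp flip: has_real_derivative_iff_has_vector_derivative)
    then show ?thesis by (simp add: I_def)
  qed
  have "(\<lambda>n. sin (a * m n) / I n) \<longlonglongrightarrow> Im (\<psi> a) / L" using s IL L by (intro tendsto_divide) auto
  moreover have "eventually (\<lambda>n. sin (a * m n) / I n = m n) sequentially"
    using order_tendstoD(1)[OF IL L] by eventually_elim (simp flip: mI)
  ultimately have "m \<longlonglongrightarrow> Im (\<psi> a) / L" by (rule Lim_transform_eventually)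
  then show ?thesis by (rule convergentI)
qed

text \<open>The modulus of the characteristic functions carries the variances alone. Once these
  converge, dividing out the Gaussian factor leaves pure oscillations whose frequencies are the
  means.\<close>

theorem (in prob_space) normal_law_limit:
  fixes W :: "nat \<Rightarrow> 'a \<Rightarrow> real"
  assumes W: "\<And>n. W n \<in> borel_measurable M" "\<And>n. 0 \<le> v n" "\<And>n. distr M borel (W n) = normal_law (m n) (v n)"
    and lim: "\<And>w. w \<in> space M \<Longrightarrow> (\<lambda>n. W n w) \<longlonglongrightarrow> Y w"
  shows "\<exists>m' v'. m \<longlonglongrightarrow> m' \<and> v \<longlonglongrightarrow> v' \<and> 0 \<le> v' \<and> distr M borel Y = normal_law m' v'"
proof -
  have [measurable]: "W n \<in> borel_measurable M" for n by (rule W)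
  have Y [measurable]: "Y \<in> borel_measurable M"
    by (rule borel_measurable_LIMSEQ_real[OF lim W(1)])
  define \<phi> where "\<phi> = char (distr M borel Y)"
  interpret D: real_distribution "distr M borel Y" by simp
  have char: "(\<lambda>n. iexp (t * m n) * complex_of_real (exp (- v n * t\<^sup>2 / 2))) \<longlonglongrightarrow> \<phi> t" for t
  proof -
    have "(\<lambda>n. \<integral>w. iexp (t * W n w) \<partial>M) \<longlonglongrightarrow> (\<integral>w. iexp (t * Y w) \<partial>M)"
      by (rule integral_dominated_convergence[where w="\<lambda>_. 1"])
        (auto intro!: tendsto_intros lim)
    also have "(\<lambda>n. \<integral>w. iexp (t * W n w) \<partial>M) = (\<lambda>n. char (distr M borel (W n)) t)"
      by (simp add: char_def integral_distr)
    also have "(\<integral>w. iexp (t * Y w) \<partial>M) = \<phi> t"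
      by (simp add: \<phi>_def char_def integral_distr)
    finally show ?thesis using W(2) by (simp add: W(3) char_normal_law)
  qed
  have "\<phi> \<midarrow>0\<rightarrow> 1" using D.isCont_char[of 0] D.char_zero by (simp add: isCont_def \<phi>_def)
  then have "eventually (\<lambda>t. \<phi> t \<noteq> 0) (at 0)" by (rule tendsto_imp_eventually_ne) simp
  then have "eventually (\<lambda>t. t \<noteq> 0 \<and> \<phi> t \<noteq> 0) (at 0)"
    using eventually_neq_at_within[of 0] by eventually_elim simp
  \<comment> \<open>The limit is a characteristic function, hence nonzero near 0. A nonzero value
    away from 0 keeps the variances from escaping to infinity and allows taking logarithms.\<close>
  then obtain t where t: "t \<noteq> 0" "\<phi> t \<noteq> 0"
    using eventually_happens by force
  have "(\<lambda>n. exp (- v n * t\<^sup>2 / 2)) \<longlonglongrightarrow> norm (\<phi> t)"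
    using tendsto_norm[OF char[of t]] by (simp add: norm_mult)
  then have "(\<lambda>n. ln (exp (- v n * t\<^sup>2 / 2))) \<longlonglongrightarrow> ln (norm (\<phi> t))" using t by (intro tendsto_ln) auto
  then have "(\<lambda>n. (- v n * t\<^sup>2 / 2) * (- 2 / t\<^sup>2)) \<longlonglongrightarrow> ln (norm (\<phi> t)) * (- 2 / t\<^sup>2)"
    by (intro tendsto_mult_right) simp
  also have "(\<lambda>n. (- v n * t\<^sup>2 / 2) * (- 2 / t\<^sup>2)) = v" using t by auto
  finally obtain v' where v': "v \<longlonglongrightarrow> v'" by blast
  then have v'0: "0 \<le> v'" using W(2) by (intro tendsto_lowerbound) auto
  \<comment> \<open>The reciprocal of the Gaussian factor converges because \<open>v\<close> does;
    multiplying by it isolates the oscillating factor for every \<open>s\<close>.\<close>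
  have *: "(\<lambda>n. (iexp (s * m n) * complex_of_real (exp (- v n * s\<^sup>2 / 2))) * complex_of_real (exp (v n * s\<^sup>2 / 2))) \<longlonglongrightarrow> \<phi> s * complex_of_real (exp (v' * s\<^sup>2 / 2))" for s
    by (intro tendsto_mult char tendsto_of_real tendsto_exp tendsto_divide tendsto_const v') simp_all
  have "(\<lambda>n. iexp (s * m n)) \<longlonglongrightarrow> \<phi> s * complex_of_real (exp (v' * s\<^sup>2 / 2))" for s
  proof -
    have "exp (- v n * s\<^sup>2 / 2) * exp (v n * s\<^sup>2 / 2) = 1" for n by (simp flip: exp_add)
    then show ?thesis using *[of s] by (simp only: mult.assoc of_real_mult[symmetric] of_real_1 mult_1_right)
  qed
  from this have "convergent m"
  proof (rule frequencies_convergent)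
    show "isCont (\<lambda>s. \<phi> s * complex_of_real (exp (v' * s\<^sup>2 / 2))) 0"
      unfolding \<phi>_def by (intro continuous_intros D.isCont_char) simp_all
  qed
  then obtain m' where m': "m \<longlonglongrightarrow> m'" by (auto simp: convergent_def)
  have "distr M borel Y = normal_law m' v'"
  proof (rule Levy_uniqueness)
    show "real_distribution (normal_law m' v')" by (rule real_distribution_normal_law[OF v'0])
    show "char (distr M borel Y) = char (normal_law m' v')"
    proof
      fix s
      have "(\<lambda>n. iexp (s * m n) * complex_of_real (exp (- v n * s\<^sup>2 / 2))) \<longlonglongrightarrow> iexp (s * m') * complex_of_real (exp (- v' * s\<^sup>2 / 2))"
        by (intro tendsto_intros v' m') simp_all
      then show "char (distr M borel Y) s = char (normal_law m' v') s"
        using LIMSEQ_unique[OF char] by (simp add: \<phi>_def char_normal_law[OF v'0])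
    qed
  qed (rule D.real_distribution_axioms)
  then show ?thesis using m' v' v'0 by blast
qed

section \<open>Linear spaces of Gaussian variables\<close>

definition cov :: "'w measure \<Rightarrow> ('w \<Rightarrow> real) \<Rightarrow> ('w \<Rightarrow> real) \<Rightarrow> real" where
  "cov M W V = (\<integral>w. (W w - integral\<^sup>L M W) * (V w - integral\<^sup>L M V) \<partial>M)"

lemma cov_commute: "cov M W V = cov M V W"
  by (simp add: cov_def mult.commute)

text \<open>Closure under sums and multiples encodes joint normality through one-dimensional laws:
  every linear form in members is a member and hence normal. Constants are included so that centred
  and shifted variables stay inside.\<close>

locale gaussian_space = prob_space M for M :: "'w measure" +
  fixes H :: "('w \<Rightarrow> real) set"
  assumes const: "(\<lambda>_. c) \<in> H"
    and add: "W \<in> H \<Longrightarrow> V \<in> H \<Longrightarrow> (\<lambda>w. W w + V w) \<in> H"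
    and scale: "W \<in> H \<Longrightarrow> (\<lambda>w. a * W w) \<in> H"
    and measurable_H: "W \<in> H \<Longrightarrow> W \<in> borel_measurable M"
    and normal: "W \<in> H \<Longrightarrow> \<exists>m v. 0 \<le> v \<and> distr M borel W = normal_law m v"
begin

lemma diff: "W \<in> H \<Longrightarrow> V \<in> H \<Longrightarrow> (\<lambda>w. W w - V w) \<in> H"
  using add[OF _ scale[of V "-1"], of W] by simp

lemma sum: "(\<And>i. i \<in> J \<Longrightarrow> W i \<in> H) \<Longrightarrow> (\<lambda>w. \<Sum>i\<in>J. W i w) \<in> H"
proof (induction J rule: infinite_finite_induct)
  case (insert i J)
  then have "(\<lambda>w. W i w + (\<Sum>i\<in>J. W i w)) \<in> H" by (intro add) simp_all
  with insert.hyps show ?case by simp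
qed (simp_all add: const)

lemma
  assumes W: "W \<in> H"
  shows integrable_H: "integrable M W"
    and integrable_H_square: "integrable M (\<lambda>w. (W w)\<^sup>2)"
    and law: "distr M borel W = normal_law (expectation W) (cov M W W)"
    and cov_nonneg: "0 \<le> cov M W W"
proof -
  have [measurable]: "W \<in> borel_measurable M" by (rule measurable_H[OF W])
  obtain m v where v: "0 \<le> v" and eq: "distr M borel W = normal_law m v"
    using normal[OF W] by (elim exE conjE)
  have "integrable (distr M borel W) (\<lambda>x. x)" unfolding eq by (rule normal_law_moments(2)[OF v])
  then show "integrable M W" by (subst (asm) integrable_distr_eq) auto
  have "integrable (distr M borel W) (\<lambda>x. x\<^sup>2)" unfolding eq by (rule normal_law_moments(1)[OF v])
  then show "integrable M (\<lambda>w. (W w)\<^sup>2)" by (subst (asm) integrable_distr_eq) auto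
  have "integral\<^sup>L (distr M borel W) (\<lambda>x. x) = m" unfolding eq by (rule normal_law_moments(3)[OF v])
  then have m: "expectation W = m" by (subst (asm) integral_distr) auto
  have "integral\<^sup>L (distr M borel W) (\<lambda>x. (x - m)\<^sup>2) = v" unfolding eq by (rule normal_law_moments(4)[OF v])
  then have "expectation (\<lambda>w. (W w - m)\<^sup>2) = v" by (subst (asm) integral_distr) auto
  then have v': "cov M W W = v" unfolding cov_def m power2_eq_square .
  show "distr M borel W = normal_law (expectation W) (cov M W W)" unfolding m v' by (rule eq)
  show "0 \<le> cov M W W" unfolding v' by (rule v)
qed

lemma integrable_H_mult:
  assumes "W \<in> H" "V \<in> H"
  shows "integrable M (\<lambda>w. W w * V w)"
proof -
  have "(\<lambda>w. W w * V w) = (\<lambda>w. ((W w + V w)\<^sup>2 - (W w)\<^sup>2 - (V w)\<^sup>2) / 2)"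
    by (auto simp: power2_eq_square algebra_simps)
  then show ?thesis
    using assms by (auto intro!: Bochner_Integration.integrable_diff integrable_H_square add)
qed

lemma cov_eq:
  assumes "W \<in> H" "V \<in> H"
  shows "cov M W V = expectation (\<lambda>w. W w * V w) - expectation W * expectation V"
proof -
  have "cov M W V = (\<integral>w. W w * V w - expectation V * W w - expectation W * V w + expectation W * expectation V \<partial>M)"
    unfolding cov_def by (simp add: algebra_simps)
  also have "\<dots> = expectation (\<lambda>w. W w * V w) - expectation W * expectation V"
    using assms by (simp add: integrable_H integrable_H_mult prob_space)
  finally show ?thesis .
qed

lemma cov_add_left:
  "W \<in> H \<Longrightarrow> W' \<in> H \<Longrightarrow> V \<in> H \<Longrightarrow> cov M (\<lambda>w. W w + W' w) V = cov M W V + cov M W' V"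
  by (simp add: cov_eq add integrable_H integrable_H_mult distrib_right)

lemma cov_scale_left:
  "W \<in> H \<Longrightarrow> V \<in> H \<Longrightarrow> cov M (\<lambda>w. a * W w) V = a * cov M W V"
  by (simp add: cov_eq scale mult.assoc right_diff_distrib)

lemma cov_const_left: "cov M (\<lambda>_. a) V = 0"
  by (simp add: cov_def prob_space)

lemma cov_sum_left:
  assumes "\<And>i. i \<in> J \<Longrightarrow> W i \<in> H" "V \<in> H"
  shows "cov M (\<lambda>w. \<Sum>i\<in>J. W i w) V = (\<Sum>i\<in>J. cov M (W i) V)"
  using assms(1)
proof (induction J rule: infinite_finite_induct)
  case (insert i J)
  then show ?case using cov_add_left[of "W i" "\<lambda>w. \<Sum>i\<in>J. W i w", OF _ sum assms(2)] by simp
qed (simp_all add: cov_const_left)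

lemma cov_diff_left:
  "W \<in> H \<Longrightarrow> W' \<in> H \<Longrightarrow> V \<in> H \<Longrightarrow> cov M (\<lambda>w. W w - W' w) V = cov M W V - cov M W' V"
  by (simp add: cov_eq diff integrable_H integrable_H_mult left_diff_distrib)

lemma cov_add_right:
  "W \<in> H \<Longrightarrow> W' \<in> H \<Longrightarrow> V \<in> H \<Longrightarrow> cov M V (\<lambda>w. W w + W' w) = cov M V W + cov M V W'"
  by (simp add: cov_add_left cov_commute[of M V])

lemma cov_diff_right:
  "W \<in> H \<Longrightarrow> W' \<in> H \<Longrightarrow> V \<in> H \<Longrightarrow> cov M V (\<lambda>w. W w - W' w) = cov M V W - cov M V W'"
  by (simp add: cov_diff_left cov_commute[of M V])

text \<open>Variances are parameters of one-dimensional laws, so through this identity limits of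
  laws control covariances too.\<close>

lemma cov_polarization:
  assumes "W \<in> H" "V \<in> H"
  shows "cov M W V = (cov M (\<lambda>w. W w + V w) (\<lambda>w. W w + V w) - cov M (\<lambda>w. W w - V w) (\<lambda>w. W w - V w)) / 4"
  using assms by (simp add: cov_add_left cov_add_right cov_diff_left cov_diff_right add diff cov_commute[of M V W])

lemma cov_linear_combination:
  assumes "\<And>i. i \<in> J \<Longrightarrow> W i \<in> H"
  shows "cov M (\<lambda>w. \<Sum>i\<in>J. c i * W i w) (\<lambda>w. \<Sum>i\<in>J. c i * W i w)
    = (\<Sum>i\<in>J. \<Sum>j\<in>J. c i * c j * cov M (W i) (W j))"
proof -
  have S: "(\<lambda>w. \<Sum>i\<in>J. c i * W i w) \<in> H" using assms by (intro sum scale)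
  have "cov M (\<lambda>w. \<Sum>i\<in>J. c i * W i w) (\<lambda>w. \<Sum>i\<in>J. c i * W i w)
    = (\<Sum>i\<in>J. c i * cov M (\<lambda>w. \<Sum>j\<in>J. c j * W j w) (W i))"
    using assms S by (subst cov_sum_left) (auto simp: scale cov_scale_left cov_commute[of M "\<lambda>w. \<Sum>i\<in>J. c i * W i w"] intro!: sum.cong)
  also have "\<dots> = (\<Sum>i\<in>J. \<Sum>j\<in>J. c i * c j * cov M (W i) (W j))"
  proof (intro sum.cong refl)
    fix i assume i: "i \<in> J"
    have "cov M (\<lambda>w. \<Sum>j\<in>J. c j * W j w) (W i) = (\<Sum>j\<in>J. c j * cov M (W i) (W j))"
      using assms i by (subst cov_sum_left) (auto simp: scale cov_scale_left cov_commute[of M "W i"] intro!: sum.cong)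
    then show "c i * cov M (\<lambda>w. \<Sum>j\<in>J. c j * W j w) (W i) = (\<Sum>j\<in>J. c i * c j * cov M (W i) (W j))"
      by (simp add: sum_distrib_left mult.assoc)
  qed
  finally show ?thesis .
qed

lemma gaussian_family_H:
  assumes "\<And>i. i \<in> I \<Longrightarrow> Y i \<in> H"
  shows "gaussian_family M I Y (\<lambda>i. expectation (Y i)) (\<lambda>i j. cov M (Y i) (Y j))"
  unfolding gaussian_family_def
proof (intro conjI ballI allI impI)
  show "prob_space M" by (rule prob_space_axioms)
  show "Y i \<in> borel_measurable M" if "i \<in> I" for i using that assms measurable_H by blast
  show "cov M (Y i) (Y j) = cov M (Y j) (Y i)" for i j by (rule cov_commute)
  fix J c assume J: "finite J \<and> J \<subseteq> I"
  then have YJ: "\<And>i. i \<in> J \<Longrightarrow> Y i \<in> H" using assms by blast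
  then have S: "(\<lambda>w. \<Sum>i\<in>J. c i * Y i w) \<in> H" by (intro sum scale)
  have v: "cov M (\<lambda>w. \<Sum>i\<in>J. c i * Y i w) (\<lambda>w. \<Sum>i\<in>J. c i * Y i w) = (\<Sum>i\<in>J. \<Sum>j\<in>J. c i * c j * cov M (Y i) (Y j))"
    using YJ by (rule cov_linear_combination)
  have m: "expectation (\<lambda>w. \<Sum>i\<in>J. c i * Y i w) = (\<Sum>i\<in>J. c i * expectation (Y i))"
    using integrable_H[OF YJ] by simp
  show "0 \<le> (\<Sum>i\<in>J. \<Sum>j\<in>J. c i * c j * cov M (Y i) (Y j))"
    using cov_nonneg[OF S] v by simp
  show "distr M borel (\<lambda>w. \<Sum>i\<in>J. c i * Y i w) =
          normal_law (\<Sum>i\<in>J. c i * expectation (Y i)) (\<Sum>i\<in>J. \<Sum>j\<in>J. c i * c j * cov M (Y i) (Y j))"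
    using law[OF S] v m by simp
qed

text \<open>\<open>normal_law_limit\<close> supplies a limiting normal law of \<open>Y\<close>;
  since the parameters of a normal law are unique, they must be the moments of
  \<open>Y\<close>.\<close>

lemma
  assumes W: "\<And>n. W n \<in> H" "\<And>w. w \<in> space M \<Longrightarrow> (\<lambda>n. W n w) \<longlonglongrightarrow> Y w" and Y: "Y \<in> H"
  shows expectation_tendsto: "(\<lambda>n. expectation (W n)) \<longlonglongrightarrow> expectation Y"
    and variance_tendsto: "(\<lambda>n. cov M (W n) (W n)) \<longlonglongrightarrow> cov M Y Y"
proof -
  obtain m v where *: "(\<lambda>n. expectation (W n)) \<longlonglongrightarrow> m" "(\<lambda>n. cov M (W n) (W n)) \<longlonglongrightarrow> v" "0 \<le> v"
      "distr M borel Y = normal_law m v"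
    using normal_law_limit[OF measurable_H[OF W(1)] cov_nonneg[OF W(1)] law[OF W(1)] W(2)] by blast
  have "expectation Y = m" "cov M Y Y = v"
    using normal_law_inject[OF cov_nonneg[OF Y] *(3) trans[OF law[OF Y, symmetric] *(4)]] by simp_all
  then show "(\<lambda>n. expectation (W n)) \<longlonglongrightarrow> expectation Y" "(\<lambda>n. cov M (W n) (W n)) \<longlonglongrightarrow> cov M Y Y"
    using * by simp_all
qed

lemma cov_tendsto:
  assumes W: "\<And>n. W n \<in> H" "\<And>w. w \<in> space M \<Longrightarrow> (\<lambda>n. W n w) \<longlonglongrightarrow> Y w" and Y: "Y \<in> H" and V: "V \<in> H"
  shows "(\<lambda>n. cov M (W n) V) \<longlonglongrightarrow> cov M Y V"
  unfolding cov_polarization[OF W(1) V] cov_polarization[OF Y V]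
  by (intro tendsto_intros variance_tendsto add diff assms) simp_all

end

section \<open>Construction of Gaussian spaces: pointwise limits and affine combinations\<close>

text \<open>One passage to the limit is enough: a mixed second derivative of the kernel is reached
  by two successive covariance limits, each with one slot held fixed at a member of the
  space.\<close>

definition pointwise_limits :: "'w measure \<Rightarrow> ('w \<Rightarrow> real) set \<Rightarrow> ('w \<Rightarrow> real) set" where
  "pointwise_limits M H = {Y. \<exists>W. (\<forall>n. W n \<in> H) \<and> (\<forall>w\<in>space M. (\<lambda>n::nat. W n w) \<longlonglongrightarrow> Y w)}"

lemma subset_pointwise_limits: "H \<subseteq> pointwise_limits M H"
  unfolding pointwise_limits_def by (auto intro!: exI[of _ "\<lambda>_. _"])

lemma (in gaussian_space) gaussian_space_pointwise_limits: "gaussian_space M (pointwise_limits M H)"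
proof
  show "(\<lambda>_. c) \<in> pointwise_limits M H" for c using subset_pointwise_limits const by blast
next
  fix Y Z assume "Y \<in> pointwise_limits M H" "Z \<in> pointwise_limits M H"
  then obtain W V where "\<forall>n. W n \<in> H" "\<forall>w\<in>space M. (\<lambda>n::nat. W n w) \<longlonglongrightarrow> Y w"
      "\<forall>n. V n \<in> H" "\<forall>w\<in>space M. (\<lambda>n::nat. V n w) \<longlonglongrightarrow> Z w"
    unfolding pointwise_limits_def by blast
  then show "(\<lambda>w. Y w + Z w) \<in> pointwise_limits M H"
    unfolding pointwise_limits_def by (intro CollectI exI[of _ "\<lambda>n w. W n w + V n w"]) (simp add: add tendsto_add)
next
  fix Y a assume "Y \<in> pointwise_limits M H"
  then obtain W where "\<forall>n. W n \<in> H" "\<forall>w\<in>space M. (\<lambda>n::nat. W n w) \<longlonglongrightarrow> Y w"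
    unfolding pointwise_limits_def by blast
  then show "(\<lambda>w. a * Y w) \<in> pointwise_limits M H"
    unfolding pointwise_limits_def by (intro CollectI exI[of _ "\<lambda>n w. a * W n w"]) (simp add: scale tendsto_mult_left)
next
  fix Y assume "Y \<in> pointwise_limits M H"
  then obtain W where W: "\<And>n. W n \<in> H" "\<And>w. w \<in> space M \<Longrightarrow> (\<lambda>n::nat. W n w) \<longlonglongrightarrow> Y w"
    unfolding pointwise_limits_def by blast
  show "Y \<in> borel_measurable M" by (rule borel_measurable_LIMSEQ_real[OF W(2) measurable_H[OF W(1)]])
  show "\<exists>m v. 0 \<le> v \<and> distr M borel Y = normal_law m v"
    using normal_law_limit[OF measurable_H[OF W(1)] cov_nonneg[OF W(1)] law[OF W(1)] W(2)] by blast
qed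

definition affine_combinations :: "'i set \<Rightarrow> ('i \<Rightarrow> 'w \<Rightarrow> real) \<Rightarrow> ('w \<Rightarrow> real) set" where
  "affine_combinations I Y = {W. \<exists>J c a. finite J \<and> J \<subseteq> I \<and> W = (\<lambda>w. a + (\<Sum>i\<in>J. c i * Y i w))}"

lemma affine_combinations_base: "i \<in> I \<Longrightarrow> Y i \<in> affine_combinations I Y"
  unfolding affine_combinations_def
  by (intro CollectI exI[of _ "{i}"] exI[of _ "\<lambda>_. 1"] exI[of _ 0]) auto

lemma normal_law_shift:
  assumes "0 \<le> v"
  shows "distr (normal_law m v) borel (\<lambda>x. a + x) = normal_law (a + m) v"
  unfolding normal_law_eq_distr[OF assms] by (subst distr_distr) (auto simp: comp_def add.assoc)

lemma gaussian_family_law: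
  assumes "gaussian_family M I Y m C" "finite J" "J \<subseteq> I"
  shows "0 \<le> (\<Sum>i\<in>J. \<Sum>j\<in>J. c i * c j * C i j)"
    and "distr M borel (\<lambda>w. \<Sum>i\<in>J. c i * Y i w) =
      normal_law (\<Sum>i\<in>J. c i * m i) (\<Sum>i\<in>J. \<Sum>j\<in>J. c i * c j * C i j)"
  using assms by (simp_all add: gaussian_family_def)

lemma gaussian_space_affine_combinations:
  assumes "gaussian_family M I Y m C"
  shows "gaussian_space M (affine_combinations I Y)"
proof -
  interpret prob_space M using assms by (simp add: gaussian_family_def)
  have Y: "Y i \<in> borel_measurable M" if "i \<in> I" for i using assms that by (simp add: gaussian_family_def)
  show ?thesis
  proof
    show "(\<lambda>_. a) \<in> affine_combinations I Y" for a
      unfolding affine_combinations_def by (intro CollectI exI[of _ "{}"] exI[of _ "\<lambda>_. 0"] exI[of _ a]) auto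
  next
    fix W V assume "W \<in> affine_combinations I Y" "V \<in> affine_combinations I Y"
    then obtain J c a K d b where J: "finite J" "J \<subseteq> I" "W = (\<lambda>w. a + (\<Sum>i\<in>J. c i * Y i w))"
      and K: "finite K" "K \<subseteq> I" "V = (\<lambda>w. b + (\<Sum>i\<in>K. d i * Y i w))"
      unfolding affine_combinations_def by blast
    \<comment> \<open>The two combinations may use different finite index sets; their coefficients
      are extended by zero to the union.\<close>
    define c' where "c' i = (if i \<in> J then c i else 0)" for i
    define d' where "d' i = (if i \<in> K then d i else 0)" for i
    have "(\<Sum>i\<in>J. c i * Y i w) = (\<Sum>i\<in>J \<union> K. c' i * Y i w)" for w
      using J K by (intro sum.mono_neutral_cong_left) (auto simp: c'_def)
    moreover have "(\<Sum>i\<in>K. d i * Y i w) = (\<Sum>i\<in>J \<union> K. d' i * Y i w)" for w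
      using J K by (intro sum.mono_neutral_cong_left) (auto simp: d'_def)
    ultimately have "(\<lambda>w. W w + V w) = (\<lambda>w. (a + b) + (\<Sum>i\<in>J \<union> K. (c' i + d' i) * Y i w))"
      using J K by (auto simp: distrib_right sum.distrib)
    then show "(\<lambda>w. W w + V w) \<in> affine_combinations I Y"
      unfolding affine_combinations_def using J(1,2) K(1,2)
      by (intro CollectI exI[of _ "J \<union> K"] exI[of _ "\<lambda>i. c' i + d' i"] exI[of _ "a + b"]) simp
  next
    fix W b assume "W \<in> affine_combinations I Y"
    then obtain J c a where J: "finite J" "J \<subseteq> I" "W = (\<lambda>w. a + (\<Sum>i\<in>J. c i * Y i w))"
      unfolding affine_combinations_def by blast
    then have "(\<lambda>w. b * W w) = (\<lambda>w. b * a + (\<Sum>i\<in>J. (b * c i) * Y i w))"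
      by (simp add: distrib_left sum_distrib_left mult.assoc)
    then show "(\<lambda>w. b * W w) \<in> affine_combinations I Y"
      unfolding affine_combinations_def using J(1,2)
      by (intro CollectI exI[of _ J] exI[of _ "\<lambda>i. b * c i"] exI[of _ "b * a"]) simp
  next
    fix W assume "W \<in> affine_combinations I Y"
    then obtain J c a where J: "finite J" "J \<subseteq> I" "W = (\<lambda>w. a + (\<Sum>i\<in>J. c i * Y i w))"
      unfolding affine_combinations_def by blast
    have S [measurable]: "(\<lambda>w. \<Sum>i\<in>J. c i * Y i w) \<in> borel_measurable M"
      using J Y by (intro borel_measurable_sum borel_measurable_times) auto
    show "W \<in> borel_measurable M" unfolding J by simp
    define v where "v = (\<Sum>i\<in>J. \<Sum>j\<in>J. c i * c j * C i j)"
    define m' where "m' = (\<Sum>i\<in>J. c i * m i)"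
    have v: "0 \<le> v" "distr M borel (\<lambda>w. \<Sum>i\<in>J. c i * Y i w) = normal_law m' v"
      unfolding v_def m'_def by (rule gaussian_family_law[OF assms J(1,2)])+
    have "distr M borel W = distr (distr M borel (\<lambda>w. \<Sum>i\<in>J. c i * Y i w)) borel (\<lambda>x. a + x)"
      unfolding J by (subst distr_distr) (auto simp: comp_def)
    then have "distr M borel W = normal_law (a + m') v" using v by (simp add: normal_law_shift)
    then show "\<exists>m v. 0 \<le> v \<and> distr M borel W = normal_law m v" using v by blast
  qed
qed

text \<open>The mean and covariance functions of a Gaussian family are read off the laws of
  \<open>Y i\<close> and \<open>Y i + Y j\<close>.\<close>
lemma
  assumes G: "gaussian_family M I Y m C"
  shows gaussian_family_expectation: "i \<in> I \<Longrightarrow> integral\<^sup>L M (Y i) = m i"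
    and gaussian_family_cov: "i \<in> I \<Longrightarrow> j \<in> I \<Longrightarrow> cov M (Y i) (Y j) = C i j"
proof -
  interpret gaussian_space M "affine_combinations I Y" by (rule gaussian_space_affine_combinations[OF G])
  note law' = gaussian_family_law[OF G, where c="\<lambda>_. 1", unfolded mult_1]
  have *: "expectation (Y i) = m i" "cov M (Y i) (Y i) = C i i" if "i \<in> I" for i
  proof -
    have b: "Y i \<in> affine_combinations I Y" by (rule affine_combinations_base[OF that])
    have "0 \<le> C i i" "distr M borel (Y i) = normal_law (m i) (C i i)"
      using law'[of "{i}"] that by simp_all
    then show "expectation (Y i) = m i" "cov M (Y i) (Y i) = C i i"
      using normal_law_inject[OF cov_nonneg[OF b], of "C i i"] law[OF b] by metis+
  qed
  show "integral\<^sup>L M (Y i) = m i" if "i \<in> I" using * that by simp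
  show "cov M (Y i) (Y j) = C i j" if i: "i \<in> I" and j: "j \<in> I"
  \<comment> \<open>For \<open>i = j\<close> the set \<open>{i, j}\<close> collapses to a singleton,
    so polarization is applied to distinct indices only.\<close>
  proof (cases "i = j")
    case False
    note bi = affine_combinations_base[OF i, of Y] and bj = affine_combinations_base[OF j, of Y]
    have b: "(\<lambda>w. Y i w + Y j w) \<in> affine_combinations I Y" by (rule add[OF bi bj])
    have sym: "C j i = C i j" using G i j unfolding gaussian_family_def by (elim conjE) blast
    have "0 \<le> C i i + C i j + (C i j + C j j)"
      "distr M borel (\<lambda>w. Y i w + Y j w) = normal_law (m i + m j) (C i i + C i j + (C i j + C j j))"
      using law'[of "{i, j}"] i j False sym by simp_all
    then have "cov M (\<lambda>w. Y i w + Y j w) (\<lambda>w. Y i w + Y j w) = C i i + C i j + (C i j + C j j)"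
      using normal_law_inject(2)[OF cov_nonneg[OF b]] law[OF b] by metis
    then show ?thesis
      using *(2)[OF i] *(2)[OF j] by (simp add: cov_add_left cov_add_right bi bj b cov_commute[of M "Y j" "Y i"])
  qed (use * i in auto)
qed

section \<open>Independence and conditional laws\<close>

context gaussian_space
begin

lemma expectation_iexp:
  assumes "W \<in> H"
  shows "(\<integral>w. iexp (W w) \<partial>M) = iexp (expectation W) * complex_of_real (exp (- cov M W W / 2))"
proof -
  have "(\<integral>w. iexp (W w) \<partial>M) = char (distr M borel W) 1"
    unfolding char_def using measurable_H[OF assms] by (subst integral_distr) auto
  also have "\<dots> = iexp (expectation W) * complex_of_real (exp (- cov M W W / 2))"
    unfolding law[OF assms] char_normal_law[OF cov_nonneg[OF assms]] by simp
  finally show ?thesis .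
qed

lemma borel_measurable_vector:
  fixes V :: "'w \<Rightarrow> 'b::euclidean_space"
  assumes "\<And>b. (\<lambda>w. b \<bullet> V w) \<in> H"
  shows "V \<in> borel_measurable M"
proof (subst borel_measurable_euclidean_space, rule ballI)
  fix i :: 'b
  show "(\<lambda>w. V w \<bullet> i) \<in> borel_measurable M"
    using measurable_H[OF assms[of i]] by (simp only: inner_commute[of i])
qed

text \<open>Every \<open>b \<bullet> V w + c \<bullet> R w\<close> is again normal, and its variance
  has no cross term; the characteristic function of the pair therefore factors into that of the
  product measure.\<close>

theorem uncorrelated_imp_independent:
  fixes V :: "'w \<Rightarrow> 'b::euclidean_space" and R :: "'w \<Rightarrow> 'c::euclidean_space"
  assumes V: "\<And>b. (\<lambda>w. b \<bullet> V w) \<in> H" and R: "\<And>c. (\<lambda>w. c \<bullet> R w) \<in> H"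
    and cov: "\<And>b c. cov M (\<lambda>w. b \<bullet> V w) (\<lambda>w. c \<bullet> R w) = 0"
  shows "distr M borel (\<lambda>w. (V w, R w)) = distr M borel V \<Otimes>\<^sub>M distr M borel R"
proof (rule multivariate_char_unique)
  have mV [measurable]: "V \<in> borel_measurable M" by (rule borel_measurable_vector[OF V])
  have mR [measurable]: "R \<in> borel_measurable M" by (rule borel_measurable_vector[OF R])
  show "prob_space (distr M borel (\<lambda>w. (V w, R w)))" by (rule prob_space_distr) measurable
  interpret PV: prob_space "distr M borel V" by (rule prob_space_distr) measurable
  interpret PR: prob_space "distr M borel R" by (rule prob_space_distr) measurable
  interpret P: pair_prob_space "distr M borel V" "distr M borel R" ..
  show "prob_space (distr M borel V \<Otimes>\<^sub>M distr M borel R)" by (rule P.prob_space_axioms)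
  show sets: "sets (distr M borel V \<Otimes>\<^sub>M distr M borel R) = sets borel"
    unfolding borel_prod[symmetric] by (rule sets_pair_measure_cong) simp_all
  fix t :: "'b \<times> 'c"
  obtain b c where t: "t = (b, c)" by (cases t)
  have exp_half: "exp (- (u + v) / 2) = exp (- u / 2) * exp (- v / 2)" for u v :: real
    unfolding exp_add[symmetric] by (simp add: field_simps)
  have char_V: "(\<integral>x. iexp (b \<bullet> x) \<partial>distr M borel V) = (\<integral>w. iexp (b \<bullet> V w) \<partial>M)"
    by (subst integral_distr) auto
  have char_R: "(\<integral>x. iexp (c \<bullet> x) \<partial>distr M borel R) = (\<integral>w. iexp (c \<bullet> R w) \<partial>M)"
    by (subst integral_distr) auto
  have "(\<integral>x. iexp (t \<bullet> x) \<partial>distr M borel (\<lambda>w. (V w, R w))) = (\<integral>w. iexp (b \<bullet> V w + c \<bullet> R w) \<partial>M)"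
    unfolding t by (subst integral_distr) auto
  also have "\<dots> = iexp (expectation (\<lambda>w. b \<bullet> V w) + expectation (\<lambda>w. c \<bullet> R w)) *
      complex_of_real (exp (- (cov M (\<lambda>w. b \<bullet> V w) (\<lambda>w. b \<bullet> V w) + cov M (\<lambda>w. c \<bullet> R w) (\<lambda>w. c \<bullet> R w)) / 2))"
    unfolding expectation_iexp[OF add[OF V R]]
    by (simp add: cov_add_left cov_add_right V R add cov cov_commute[of M "\<lambda>w. c \<bullet> R w" "\<lambda>w. b \<bullet> V w"] integrable_H)
  also have "\<dots> = (\<integral>w. iexp (b \<bullet> V w) \<partial>M) * (\<integral>w. iexp (c \<bullet> R w) \<partial>M)"
    unfolding expectation_iexp[OF V] expectation_iexp[OF R] exp_half of_real_add distrib_left exp_add of_real_mult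
    by (simp only: mult.assoc mult.left_commute)
  also have "\<dots> = (\<integral>x. (\<integral>y. iexp (t \<bullet> (x, y)) \<partial>distr M borel R) \<partial>distr M borel V)"
    by (simp add: t char_V[symmetric] char_R[symmetric] distrib_left exp_add)
  also have "\<dots> = (\<integral>x. iexp (t \<bullet> x) \<partial>(distr M borel V \<Otimes>\<^sub>M distr M borel R))"
  proof (rule P.integral_fst')
    have "(\<lambda>x. iexp (t \<bullet> x)) \<in> borel_measurable borel" by measurable
    then have "(\<lambda>x. iexp (t \<bullet> x)) \<in> borel_measurable (distr M borel V \<Otimes>\<^sub>M distr M borel R)"
      using measurable_cong_sets[OF sets refl] by blast
    then show "integrable (distr M borel V \<Otimes>\<^sub>M distr M borel R) (\<lambda>x. iexp (t \<bullet> x))"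
      by (intro P.integrable_const_bound[of _ 1]) auto
  qed
  finally show "(\<integral>x. iexp (t \<bullet> x) \<partial>distr M borel (\<lambda>w. (V w, R w))) =
      (\<integral>x. iexp (t \<bullet> x) \<partial>(distr M borel V \<Otimes>\<^sub>M distr M borel R))" .
qed simp

end

text \<open>Freezing \<open>V\<close> at \<open>z\<close> leaves \<open>a z + R\<close>, and by
  independence the law of \<open>R\<close> is unaffected by the freezing. The defining integral
  identity of the conditional expectation becomes Fubini's theorem on the product law.\<close>

lemma (in prob_space) regular_conditional_distribution_shift:
  fixes V :: "'a \<Rightarrow> 'b::euclidean_space" and R :: "'a \<Rightarrow> 'c::euclidean_space"
  assumes V [measurable]: "V \<in> borel_measurable M" and R [measurable]: "R \<in> borel_measurable M"
    and indep: "distr M borel (\<lambda>w. (V w, R w)) = distr M borel V \<Otimes>\<^sub>M distr M borel R"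
    and a [measurable]: "a \<in> borel_measurable borel"
    and U: "\<And>w. U w = a (V w) + R w"
  shows "regular_conditional_distribution M V U (\<lambda>z. distr (distr M borel R) borel (\<lambda>r. a z + r))"
  unfolding regular_conditional_distribution_def
proof (intro conjI ballI)
  define Q where "Q = (\<lambda>z. distr (distr M borel R) borel (\<lambda>r. a z + r))"
  have R_prob: "distr M borel R \<in> space (prob_algebra borel)"
    by (simp add: space_prob_algebra prob_space_distr)
  have Q: "Q \<in> borel \<rightarrow>\<^sub>M prob_algebra borel"
    unfolding Q_def
  proof (rule measurable_distr_prob_space2[where M=borel])
    show "(\<lambda>z. distr M borel R) \<in> borel \<rightarrow>\<^sub>M prob_algebra borel"
      using R_prob by (rule measurable_const)
    show "(\<lambda>(z, r). a z + r) \<in> borel \<Otimes>\<^sub>M borel \<rightarrow>\<^sub>M borel" by measurable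
  qed
  then show "(\<lambda>z. distr (distr M borel R) borel (\<lambda>r. a z + r)) \<in> borel \<rightarrow>\<^sub>M prob_algebra borel"
    by (simp add: Q_def)
  fix B :: "'c set" assume B [measurable]: "B \<in> sets borel"
  define F where "F = vimage_algebra (space M) V borel"
  have sF: "sets F = {V -` C \<inter> space M | C. C \<in> sets borel}"
    unfolding F_def by (rule sets_vimage_algebra2) auto
  have sub: "subalgebra M F"
    unfolding subalgebra_def sF by (auto simp: F_def intro: measurable_sets)
  interpret F: finite_measure_subalgebra M F by unfold_locales (rule sub)
  have mU [measurable]: "U \<in> borel_measurable M" unfolding U[abs_def] by measurable
  define q where "q z = measure (Q z) B" for z
  have q [measurable]: "q \<in> borel_measurable borel"
    unfolding q_def using measurable_compose[OF Q measurable_measure_prob_algebra[OF B]] .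
  have q01: "\<bar>q z\<bar> \<le> 1" for z
  proof -
    interpret Qz: prob_space "Q z" using measurable_space[OF Q, of z] by (simp add: space_prob_algebra)
    show ?thesis by (simp add: q_def)
  qed
  have "AE w in M. real_cond_exp M F (indicator (U -` B)) w = q (V w)"
  proof (rule F.real_cond_exp_charact)
    have "(\<lambda>w. indicator B (U w) :: real) \<in> borel_measurable M" by measurable
    then have mi: "(indicator (U -` B) :: 'a \<Rightarrow> real) \<in> borel_measurable M"
      by (simp add: indicator_vimage comp_def)
    then show "integrable M (indicator (U -` B) :: 'a \<Rightarrow> real)"
      by (intro integrable_const_bound[of _ 1]) auto
    show "integrable M (\<lambda>w. q (V w))"
      using q01 by (intro integrable_const_bound[of _ 1]) auto
    show "(\<lambda>w. q (V w)) \<in> borel_measurable F"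
      unfolding F_def by (rule measurable_compose[OF measurable_vimage_algebra1 q]) auto
    fix A assume "A \<in> sets F"
    then obtain C where C [measurable]: "C \<in> sets borel" and A: "A = V -` C \<inter> space M" unfolding sF by blast
    \<comment> \<open>Indicator of the event that \<open>V\<close> lies in \<open>C\<close> and
      \<open>U\<close> in \<open>B\<close>, written in the coordinates \<open>(V, R)\<close> whose
      joint law is a product.\<close>
    define h :: "'b \<times> 'c \<Rightarrow> real" where "h = (\<lambda>(v, r). indicator C v * indicator B (a v + r))"
    have h [measurable]: "h \<in> borel_measurable (borel \<Otimes>\<^sub>M borel)" unfolding h_def by measurable
    interpret PV: prob_space "distr M borel V" by (rule prob_space_distr) measurable
    interpret PR: prob_space "distr M borel R" by (rule prob_space_distr) measurable
    interpret P: pair_prob_space "distr M borel V" "distr M borel R" ..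
    have "(\<integral>w\<in>A. indicator (U -` B) w \<partial>M) = (\<integral>w. h (V w, R w) \<partial>M)"
      unfolding set_lebesgue_integral_def
      by (rule Bochner_Integration.integral_cong) (auto simp: A h_def U indicator_def)
    also have "\<dots> = (\<integral>x. h x \<partial>distr M borel (\<lambda>w. (V w, R w)))"
      using h unfolding borel_prod by (subst integral_distr) auto
    also have "\<dots> = (\<integral>v. (\<integral>r. h (v, r) \<partial>distr M borel R) \<partial>distr M borel V)"
      unfolding indep
    proof (rule P.integral_fst'[symmetric])
      have "h \<in> borel_measurable (distr M borel V \<Otimes>\<^sub>M distr M borel R)" by measurable
      then show "integrable (distr M borel V \<Otimes>\<^sub>M distr M borel R) h"
        by (intro P.integrable_const_bound[of _ 1]) (auto simp: h_def indicator_def)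
    qed
    also have "\<dots> = (\<integral>v. indicator C v * q v \<partial>distr M borel V)"
    proof (rule Bochner_Integration.integral_cong[OF refl])
      fix v
      have "(\<integral>r. h (v, r) \<partial>distr M borel R) = indicator C v * (\<integral>r. indicator B (a v + r) \<partial>distr M borel R)"
        by (simp add: h_def)
      also have "(\<integral>r. indicat_real B (a v + r) \<partial>distr M borel R) = (\<integral>x. indicat_real B x \<partial>Q v)"
        unfolding Q_def by (rule integral_distr[symmetric]) simp_all
      also have "\<dots> = q v" by (simp add: q_def Q_def)
      finally show "(\<integral>r. h (v, r) \<partial>distr M borel R) = indicator C v * q v" .
    qed
    also have "\<dots> = (\<integral>w. indicator C (V w) * q (V w) \<partial>M)" by (subst integral_distr) auto
    also have "\<dots> = (\<integral>w\<in>A. q (V w) \<partial>M)"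
      unfolding set_lebesgue_integral_def
      by (rule Bochner_Integration.integral_cong) (auto simp: A indicator_def)
    finally show "(\<integral>w\<in>A. indicator (U -` B) w \<partial>M) = (\<integral>w\<in>A. q (V w) \<partial>M)" .
  qed
  then show "AE w in M. real_cond_exp M (vimage_algebra (space M) V borel) (indicator (U -` B)) w =
      measure (distr (distr M borel R) borel (\<lambda>r. a (V w) + r)) B"
    by (simp add: F_def q_def Q_def)
qed

section \<open>Almost sure uniqueness of conditional laws and posterior moments\<close>

text \<open>Distribution functions are right-continuous. Countability of the test sets is the point,
  since each half-line brings its own null set when conditional laws are compared.\<close>

lemma real_measure_eqI_rational:
  assumes N: "real_distribution N" "real_distribution N'"
    and eq: "\<And>q. q \<in> \<rat> \<Longrightarrow> measure N {..q} = measure N' {..q}"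
  shows "N = N'"
proof (rule cdf_unique[OF N])
  interpret N: real_distribution N by fact
  interpret N': real_distribution N' by fact
  have "cdf N x = cdf N' x" for x
  proof (rule ccontr)
    assume "cdf N x \<noteq> cdf N' x"
    moreover have "((\<lambda>y. cdf N y - cdf N' y) \<longlongrightarrow> cdf N x - cdf N' x) (at_right x)"
      using N.cdf_is_right_cont[of x] N'.cdf_is_right_cont[of x]
      by (intro tendsto_diff) (simp_all add: continuous_within)
    ultimately have "eventually (\<lambda>y. cdf N y - cdf N' y \<noteq> 0) (at_right x)"
      by (intro tendsto_imp_eventually_ne) auto
    then obtain b where b: "b > x" "\<And>y. x < y \<Longrightarrow> y < b \<Longrightarrow> cdf N y - cdf N' y \<noteq> 0"
      unfolding eventually_at_right_field by blast
    then show False using Rats_dense_in_real[OF b(1)] eq by (auto simp: cdf_def)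
  qed
  then show "cdf N = cdf N'" by blast
qed

text \<open>On a fixed Borel set both kernels give versions of the same conditional expectation.
  Pushing forward along \<open>g\<close> leaves only half-lines with rational endpoints to
  compare.\<close>

lemma regular_conditional_distribution_unique:
  fixes U :: "'w \<Rightarrow> 'c::topological_space" and g :: "'c \<Rightarrow> real"
  assumes V: "V \<in> borel_measurable M"
    and Q: "regular_conditional_distribution M V U Q" "regular_conditional_distribution M V U Q'"
    and g [measurable]: "g \<in> borel_measurable borel"
  shows "AE w in M. distr (Q (V w)) borel g = distr (Q' (V w)) borel g"
proof -
  have *: "AE w in M. measure (Q (V w)) (g -` {..q}) = measure (Q' (V w)) (g -` {..q})" for q
  proof -
    have "g -` {..q} \<in> sets borel" using measurable_sets[OF g, of "{..q}"] by simp
    then have "AE w in M. real_cond_exp M (vimage_algebra (space M) V borel) (indicator (U -` (g -` {..q}))) w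
          = measure (Q (V w)) (g -` {..q})"
        "AE w in M. real_cond_exp M (vimage_algebra (space M) V borel) (indicator (U -` (g -` {..q}))) w
          = measure (Q' (V w)) (g -` {..q})"
      using Q unfolding regular_conditional_distribution_def by blast+
    then show ?thesis by eventually_elim simp
  qed
  have "AE w in M. \<forall>q\<in>\<rat>. measure (Q (V w)) (g -` {..q}) = measure (Q' (V w)) (g -` {..q})"
    unfolding AE_ball_countable[OF countable_rat] using * by blast
  then show ?thesis
  proof eventually_elim
    case (elim w)
    have dist: "sets (Q'' (V w)) = sets borel" "prob_space (Q'' (V w))"
      if "regular_conditional_distribution M V U Q''" for Q''
      using that measurable_space[of Q'' borel "prob_algebra borel" "V w"]
      unfolding regular_conditional_distribution_def by (auto simp: space_prob_algebra)
    have m: "g \<in> borel_measurable (Q'' (V w))" "space (Q'' (V w)) = UNIV"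
      if "regular_conditional_distribution M V U Q''" for Q''
      using dist[OF that] g measurable_cong_sets[OF dist(1)[OF that] refl] sets_eq_imp_space_eq[OF dist(1)[OF that]] by auto
    show ?case
    proof (rule real_measure_eqI_rational)
      show "real_distribution (distr (Q (V w)) borel g)" "real_distribution (distr (Q' (V w)) borel g)"
        using dist Q m by (auto intro!: prob_space.real_distribution_distr)
      show "measure (distr (Q (V w)) borel g) {..q} = measure (distr (Q' (V w)) borel g) {..q}" if "q \<in> \<rat>" for q
        using elim that m[OF Q(1)] m[OF Q(2)] by (simp add: measure_distr)
    qed
  qed
qed

text \<open>Coefficients 0 and 1 suffice: singletons \<open>J\<close> give the means and the
  diagonal, and two-element sets then give the off-diagonal entries by symmetry.\<close>

lemma multivariate_normal_unique:
  fixes N N' :: "(real^'d) measure"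
  assumes N: "multivariate_normal N m S" and N': "multivariate_normal N' m' S'"
    and eq: "\<And>J. distr N borel (\<lambda>x. \<Sum>i\<in>J. x $ i) = distr N' borel (\<lambda>x. \<Sum>i\<in>J. x $ i)"
  shows "m = m'" "S = S'"
proof -
  have G: "gaussian_family N UNIV (\<lambda>i v. v $ i) (\<lambda>i. m $ i) (\<lambda>i j. S $ i $ j)"
    and G': "gaussian_family N' UNIV (\<lambda>i v. v $ i) (\<lambda>i. m' $ i) (\<lambda>i j. S' $ i $ j)"
    using N N' by (auto simp: multivariate_normal_def)
  note law = gaussian_family_law[OF G, where c="\<lambda>_. 1", unfolded mult_1]
  note law' = gaussian_family_law[OF G', where c="\<lambda>_. 1", unfolded mult_1]
  have m: "(\<Sum>i\<in>J. m $ i) = (\<Sum>i\<in>J. m' $ i)"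
    and S: "(\<Sum>i\<in>J. \<Sum>j\<in>J. S $ i $ j) = (\<Sum>i\<in>J. \<Sum>j\<in>J. S' $ i $ j)" for J
  proof -
    have fin: "finite J" "J \<subseteq> UNIV" by simp_all
    have "normal_law (\<Sum>i\<in>J. m $ i) (\<Sum>i\<in>J. \<Sum>j\<in>J. S $ i $ j)
        = normal_law (\<Sum>i\<in>J. m' $ i) (\<Sum>i\<in>J. \<Sum>j\<in>J. S' $ i $ j)"
      unfolding law(2)[OF fin, symmetric] law'(2)[OF fin, symmetric] by (rule eq)
    from normal_law_inject[OF law(1)[OF fin] law'(1)[OF fin] this]
    show "(\<Sum>i\<in>J. m $ i) = (\<Sum>i\<in>J. m' $ i)"
      "(\<Sum>i\<in>J. \<Sum>j\<in>J. S $ i $ j) = (\<Sum>i\<in>J. \<Sum>j\<in>J. S' $ i $ j)" .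
  qed
  show "m = m'" using m[of "{_}"] by (simp add: vec_eq_iff)
  have d: "S $ i $ i = S' $ i $ i" for i using S[of "{i}"] by simp
  have sym: "S $ i $ j = S $ j $ i" "S' $ i $ j = S' $ j $ i" for i j
    using G G' unfolding gaussian_family_def by blast+
  have "S $ i $ j = S' $ i $ j" for i j
  proof (cases "i = j")
    case False
    then show ?thesis using S[of "{i, j}"] d[of i] d[of j] sym(1)[of j i] sym(2)[of j i] by simp
  qed (simp add: d)
  then show "S = S'" by (simp add: vec_eq_iff)
qed

theorem gaussian_posterior_unique:
  fixes U :: "'w \<Rightarrow> real^'d"
  assumes V: "V \<in> borel_measurable M"
    and P: "gaussian_posterior M V U m S" "gaussian_posterior M V U m' S'"
  shows "AE w in M. m (V w) = m' (V w) \<and> S (V w) = S' (V w)"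
proof -
  obtain Q Q' where Q: "regular_conditional_distribution M V U Q" "AE w in M. multivariate_normal (Q (V w)) (m (V w)) (S (V w))"
    and Q': "regular_conditional_distribution M V U Q'" "AE w in M. multivariate_normal (Q' (V w)) (m' (V w)) (S' (V w))"
    using P unfolding gaussian_posterior_def by blast
  \<comment> \<open>The index type is finite, so there are only finitely many \<open>J\<close> and
    the exceptional null sets can be united.\<close>
  have "AE w in M. \<forall>J\<in>UNIV. distr (Q (V w)) borel (\<lambda>x. \<Sum>i\<in>J. x $ i) = distr (Q' (V w)) borel (\<lambda>x. \<Sum>i\<in>J. x $ i)"
    by (intro AE_finite_allI regular_conditional_distribution_unique[OF V Q(1) Q'(1)]) simp_all
  with Q(2) Q'(2) show ?thesis
  proof eventually_elim
    case (elim w)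
    then show ?case using multivariate_normal_unique[OF elim(1,2)] by blast
  qed
qed

lemma gaussian_family_distr:
  assumes T [measurable]: "T \<in> M \<rightarrow>\<^sub>M N" and Y [measurable]: "\<And>i. i \<in> I \<Longrightarrow> Y i \<in> borel_measurable N"
    and G: "gaussian_family M I (\<lambda>i w. Y i (T w)) m C"
  shows "gaussian_family (distr M N T) I Y m C"
  unfolding gaussian_family_def
proof (intro conjI ballI allI impI)
  interpret prob_space M using G by (simp add: gaussian_family_def)
  show "prob_space (distr M N T)" by (rule prob_space_distr[OF T])
  show "Y i \<in> borel_measurable (distr M N T)" if "i \<in> I" for i using Y[OF that] by simp
  show "C i j = C j i" if "i \<in> I" "j \<in> I" for i j using G that unfolding gaussian_family_def by blast
  fix J c assume J: "finite J \<and> J \<subseteq> I"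
  show "0 \<le> (\<Sum>i\<in>J. \<Sum>j\<in>J. c i * c j * C i j)" using gaussian_family_law(1)[OF G] J by blast
  have "(\<lambda>x. \<Sum>i\<in>J. c i * Y i x) \<in> borel_measurable N"
    using J Y by (intro borel_measurable_sum borel_measurable_times) auto
  then have "distr (distr M N T) borel (\<lambda>x. \<Sum>i\<in>J. c i * Y i x) = distr M borel (\<lambda>w. \<Sum>i\<in>J. c i * Y i (T w))"
    using T by (subst distr_distr) (auto simp: comp_def)
  then show "distr (distr M N T) borel (\<lambda>x. \<Sum>i\<in>J. c i * Y i x) =
      normal_law (\<Sum>i\<in>J. c i * m i) (\<Sum>i\<in>J. \<Sum>j\<in>J. c i * c j * C i j)"
    using gaussian_family_law(2)[OF G] J by simp
qed

section \<open>Gaussian conditioning and differentiation of covariances\<close>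

lemma matrix_inv_mult_left:
  assumes "invertible A"
  shows "matrix_inv A ** A = mat 1"
  using someI_ex[OF assms[unfolded invertible_def]] by (simp add: matrix_inv_def)

context gaussian_space
begin

lemma multivariate_normal_distr:
  fixes R :: "'w \<Rightarrow> real^'d"
  assumes R: "\<And>r. (\<lambda>w. R w $ r) \<in> H"
  shows "multivariate_normal (distr M borel R) (\<chi> r. expectation (\<lambda>w. R w $ r))
    (\<chi> r s. cov M (\<lambda>w. R w $ r) (\<lambda>w. R w $ s))"
  unfolding multivariate_normal_def
proof (intro conjI gaussian_family_distr)
  show "R \<in> borel_measurable M"
  proof (rule borel_measurable_vector)
    show "(\<lambda>w. b \<bullet> R w) \<in> H" for b
      unfolding inner_vec_def by (intro sum) (simp add: scale R)
  qed
  show "gaussian_family M UNIV (\<lambda>i w. R w $ i) (\<lambda>i. (\<chi> r. expectation (\<lambda>w. R w $ r)) $ i)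
     (\<lambda>i j. (\<chi> r s. cov M (\<lambda>w. R w $ r) (\<lambda>w. R w $ s)) $ i $ j)"
    using gaussian_family_H[of UNIV "\<lambda>i w. R w $ i"] R by simp
qed simp_all

theorem gaussian_conditioning:
  fixes U :: "'w \<Rightarrow> real^'d" and V :: "'w \<Rightarrow> real^'k"
  assumes U: "\<And>r. (\<lambda>w. U w $ r) \<in> H" and V: "\<And>j. (\<lambda>w. V w $ j) \<in> H"
    and K: "K = (\<chi> i j. cov M (\<lambda>w. V w $ i) (\<lambda>w. V w $ j))"
    and A: "A = (\<chi> r j. cov M (\<lambda>w. U w $ r) (\<lambda>w. V w $ j))"
    and K0: "K0 = (\<chi> r s. cov M (\<lambda>w. U w $ r) (\<lambda>w. U w $ s))"
    and mU: "mU = (\<chi> r. expectation (\<lambda>w. U w $ r))"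
    and mV: "mV = (\<chi> j. expectation (\<lambda>w. V w $ j))"
    and inv: "invertible K"
  shows "gaussian_posterior M V U (\<lambda>z. mU + (A ** matrix_inv K) *v (z - mV))
    (\<lambda>z. K0 - A ** matrix_inv K ** transpose A)"
proof -
  \<comment> \<open>The regression matrix: the equation \<open>B ** K = A\<close> says exactly that
    residual and observations are uncorrelated.\<close>
  define B where "B = A ** matrix_inv K"
  define a where "a z = mU + B *v (z - mV)" for z
  define R where "R w = U w - a (V w)" for w
  have BK: "B ** K = A"
    unfolding B_def matrix_mul_assoc[symmetric] matrix_inv_mult_left[OF inv] by simp
  have a_nth: "(\<lambda>w. a (V w) $ r) = (\<lambda>w. mU $ r + (\<Sum>j\<in>UNIV. B $ r $ j * (V w $ j - mV $ j)))" for r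
    by (simp add: a_def matrix_vector_mult_def)
  have Vc: "(\<lambda>w. V w $ j - mV $ j) \<in> H" for j by (rule diff[OF V const])
  have BV: "(\<lambda>w. \<Sum>j\<in>UNIV. B $ r $ j * (V w $ j - mV $ j)) \<in> H" for r
    by (intro sum scale Vc)
  have aH: "(\<lambda>w. a (V w) $ r) \<in> H" for r unfolding a_nth by (rule add[OF const BV])
  have R_nth: "(\<lambda>w. R w $ r) = (\<lambda>w. U w $ r - a (V w) $ r)" for r by (simp add: R_def)
  have RH: "(\<lambda>w. R w $ r) \<in> H" for r unfolding R_nth by (rule diff[OF U aH])
  have cov_a: "cov M (\<lambda>w. a (V w) $ r) W = (\<Sum>j\<in>UNIV. B $ r $ j * cov M (\<lambda>w. V w $ j) W)" if W: "W \<in> H" for r W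
  proof -
    have "cov M (\<lambda>w. a (V w) $ r) W = (\<Sum>j\<in>UNIV. cov M (\<lambda>w. B $ r $ j * (V w $ j - mV $ j)) W)"
      unfolding a_nth cov_add_left[OF const BV W] cov_const_left
      by (subst cov_sum_left) (simp_all add: scale Vc W)
    also have "\<dots> = (\<Sum>j\<in>UNIV. B $ r $ j * cov M (\<lambda>w. V w $ j) W)"
      by (simp add: cov_scale_left[OF Vc W] cov_diff_left[OF V const W] cov_const_left)
    finally show ?thesis .
  qed
  have RV: "cov M (\<lambda>w. R w $ r) (\<lambda>w. V w $ j) = 0" for r j
  proof -
    have "cov M (\<lambda>w. R w $ r) (\<lambda>w. V w $ j) = A $ r $ j - (B ** K) $ r $ j"
      unfolding R_nth cov_diff_left[OF U aH V] cov_a[OF V]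
      by (simp add: A K matrix_matrix_mult_def)
    then show ?thesis by (simp add: BK)
  qed
  have RR: "cov M (\<lambda>w. R w $ r) (\<lambda>w. R w $ s) = (K0 - B ** transpose A) $ r $ s" for r s
  proof -
    \<comment> \<open>\<open>a (V w)\<close> is affine in the observations, with which the residual
      is uncorrelated; so one of the two factors \<open>R\<close> may be replaced by
      \<open>U\<close>, and the quadratic expression in \<open>B\<close> collapses.\<close>
    have "cov M (\<lambda>w. R w $ r) (\<lambda>w. a (V w) $ s) = 0"
      unfolding cov_commute[of M "\<lambda>w. R w $ r"] cov_a[OF RH]
      by (simp add: cov_commute[of M _ "\<lambda>w. R w $ r"] RV)
    then have "cov M (\<lambda>w. R w $ r) (\<lambda>w. R w $ s) = cov M (\<lambda>w. R w $ r) (\<lambda>w. U w $ s)"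
      unfolding R_nth[of s] cov_diff_right[OF U aH RH] by simp
    also have "\<dots> = K0 $ r $ s - (\<Sum>j\<in>UNIV. B $ r $ j * cov M (\<lambda>w. V w $ j) (\<lambda>w. U w $ s))"
      unfolding R_nth cov_diff_left[OF U aH U] cov_a[OF U] by (simp add: K0)
    also have "\<dots> = (K0 - B ** transpose A) $ r $ s"
      by (simp add: A matrix_matrix_mult_def transpose_def cov_commute[of M _ "\<lambda>w. U w $ s"])
    finally show ?thesis .
  qed
  \<comment> \<open>A centred residual makes \<open>a z\<close> itself the posterior mean.\<close>
  have ER: "expectation (\<lambda>w. R w $ r) = 0" for r
  proof -
    have "expectation (\<lambda>w. V w $ j - mV $ j) = 0" for j
      using integrable_H[OF V] by (simp add: mV prob_space)
    then have "expectation (\<lambda>w. a (V w) $ r) = mU $ r"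
      unfolding a_nth using integrable_H[OF BV] integrable_H[OF Vc]
      by (simp add: Bochner_Integration.integral_sum prob_space)
    then show ?thesis
      unfolding R_nth using integrable_H[OF U] integrable_H[OF aH] by (simp add: mU)
  qed
  have vH: "(\<lambda>w. b \<bullet> Y w) \<in> H" if "\<And>i. (\<lambda>w. Y w $ i) \<in> H" for b and Y :: "'w \<Rightarrow> real^'m"
    unfolding inner_vec_def by (intro sum) (simp add: scale that)
  have mVm: "V \<in> borel_measurable M" and mRm [measurable]: "R \<in> borel_measurable M"
    by (intro borel_measurable_vector vH V RH)+
  have "cov M (\<lambda>w. b \<bullet> V w) (\<lambda>w. c \<bullet> R w) = 0" for b c
  proof -
    have "cov M (\<lambda>w. c \<bullet> R w) (\<lambda>w. V w $ j) = 0" for j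
      unfolding inner_vec_def by (subst cov_sum_left) (simp_all add: scale RH V cov_scale_left RV)
    then have "cov M (\<lambda>w. V w $ j) (\<lambda>w. c \<bullet> R w) = 0" for j
      by (simp add: cov_commute[of M "\<lambda>w. V w $ j"])
    then show ?thesis
      unfolding inner_vec_def[of b] by (subst cov_sum_left) (simp_all add: scale V cov_scale_left vH RH)
  qed
  then have indep: "distr M borel (\<lambda>w. (V w, R w)) = distr M borel V \<Otimes>\<^sub>M distr M borel R"
    by (intro uncorrelated_imp_independent vH V RH)
  have am: "a \<in> borel_measurable borel"
    unfolding a_def[abs_def]
    by (intro borel_measurable_continuous_onI continuous_intros linear_continuous_on matrix_vector_mul_bounded_linear
      bounded_linear.continuous_on[OF matrix_vector_mul_bounded_linear])
  have "regular_conditional_distribution M V U (\<lambda>z. distr (distr M borel R) borel (\<lambda>r. a z + r))"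
    by (rule regular_conditional_distribution_shift[OF mVm mRm indep am]) (simp add: R_def)
  \<comment> \<open>Only the mean depends on \<open>z\<close>; the covariance is that of
    \<open>R\<close>, so the law is normal for every \<open>z\<close> and not merely for almost
    every observation.\<close>
  moreover have "multivariate_normal (distr (distr M borel R) borel (\<lambda>r. a z + r)) (a z) (K0 - B ** transpose A)" for z
  proof -
    have nth: "(\<lambda>w. (a z + R w) $ r) = (\<lambda>w. a z $ r + R w $ r)" for r by simp
    have "multivariate_normal (distr M borel (\<lambda>w. a z + R w)) (\<chi> r. expectation (\<lambda>w. (a z + R w) $ r))
      (\<chi> r s. cov M (\<lambda>w. (a z + R w) $ r) (\<lambda>w. (a z + R w) $ s))"
      by (rule multivariate_normal_distr) (unfold nth, rule add[OF const RH])
    moreover have "distr (distr M borel R) borel (\<lambda>r. a z + r) = distr M borel (\<lambda>w. a z + R w)"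
      by (subst distr_distr) (simp_all add: comp_def)
    moreover have "(\<chi> r. expectation (\<lambda>w. (a z + R w) $ r)) = a z"
      using integrable_H[OF RH] by (simp add: vec_eq_iff ER prob_space)
    moreover have "(\<chi> r s. cov M (\<lambda>w. (a z + R w) $ r) (\<lambda>w. (a z + R w) $ s)) = K0 - B ** transpose A"
    proof -
      have "cov M (\<lambda>w. (a z + R w) $ r) (\<lambda>w. (a z + R w) $ s) = (K0 - B ** transpose A) $ r $ s" for r s
      unfolding nth cov_add_left[OF const RH add[OF const RH]] cov_add_right[OF const RH RH] cov_const_left
        cov_commute[of M _ "\<lambda>w. a z $ s"] RR by simp
      then show ?thesis by (simp only: vec_eq_iff vec_lambda_beta simp_thms)
    qed
    ultimately show ?thesis by (simp only:)
  qed
  ultimately show ?thesis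
    unfolding gaussian_posterior_def B_def[symmetric] a_def[symmetric] by blast
qed

section \<open>Derivatives of means and covariances\<close>

text \<open>Difference quotients belong to \<open>H\<close> and converge pointwise to
  \<open>D\<close>, so sequential continuity of expectation and covariance applies to them. The open
  set \<open>T\<close> localizes the argument, since \<open>F t\<close> is known to lie in
  \<open>H\<close> only there.\<close>

lemma
  assumes T: "open T" "x \<in> T" and F: "\<And>t. t \<in> T \<Longrightarrow> F t \<in> H" and D: "D \<in> H"
    and deriv: "\<And>w. w \<in> space M \<Longrightarrow> ((\<lambda>t. F t w) has_real_derivative D w) (at x)"
  shows expectation_has_derivative:
      "((\<lambda>t. expectation (F t)) has_real_derivative expectation D) (at x)"
    and cov_has_derivative:
      "V \<in> H \<Longrightarrow> ((\<lambda>t. cov M (F t) V) has_real_derivative cov M D V) (at x)"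
proof -
  note at = at_within_open[OF T(2,1), symmetric]
  define q where "q t w = 1 / (t - x) * (F t w - F x w)" for t w
  have qH: "q t \<in> H" if "t \<in> T" for t
    unfolding q_def[abs_def] by (rule scale[OF diff[OF F F]]) (use that T in auto)
  have ql: "(\<lambda>n. q (X n) w) \<longlonglongrightarrow> D w"
    if "\<And>n. X n \<in> T - {x}" "X \<longlonglongrightarrow> x" "w \<in> space M" for X w
    using deriv[OF that(3)] that(1,2) unfolding has_field_derivative_iff at tendsto_at_iff_sequentially
    by (simp add: q_def comp_def)
  show "((\<lambda>t. expectation (F t)) has_real_derivative expectation D) (at x)"
    unfolding has_field_derivative_iff at tendsto_at_iff_sequentially
  proof (intro allI impI)
    fix X assume X: "\<forall>n::nat. X n \<in> T - {x}" "X \<longlonglongrightarrow> x"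
    then have "(\<lambda>n. expectation (q (X n))) \<longlonglongrightarrow> expectation D"
      by (intro expectation_tendsto qH D ql) auto
    moreover have "expectation (q (X n)) = (expectation (F (X n)) - expectation (F x)) / (X n - x)" for n
      using X integrable_H[OF F] T by (simp add: q_def[abs_def])
    ultimately show "((\<lambda>t. (expectation (F t) - expectation (F x)) / (t - x)) \<circ> X) \<longlonglongrightarrow> expectation D"
      by (simp add: comp_def)
  qed
  assume V: "V \<in> H"
  show "((\<lambda>t. cov M (F t) V) has_real_derivative cov M D V) (at x)"
    unfolding has_field_derivative_iff at tendsto_at_iff_sequentially
  proof (intro allI impI)
    fix X assume X: "\<forall>n::nat. X n \<in> T - {x}" "X \<longlonglongrightarrow> x"
    then have "(\<lambda>n. cov M (q (X n)) V) \<longlonglongrightarrow> cov M D V"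
      by (intro cov_tendsto qH D V ql) auto
    moreover have "cov M (q (X n)) V = (cov M (F (X n)) V - cov M (F x) V) / (X n - x)" for n
      unfolding q_def[abs_def]
      by (subst cov_scale_left) (use X T in \<open>simp_all add: cov_diff_left diff F V\<close>)
    ultimately show "((\<lambda>t. (cov M (F t) V - cov M (F x) V) / (t - x)) \<circ> X) \<longlonglongrightarrow> cov M D V"
      by (simp add: comp_def)
  qed
qed

end

section \<open>The posterior of a value and a gradient\<close>

text \<open>The prior mean of the value and of the gradient is an added term in the general formula;
  the version without it is asserted when both vanish at the new points. The claims about arbitrary
  \<open>m\<close> and \<open>S\<close> hold almost surely, which is as far as a posterior is
  determined.\<close>

theorem theorem1:
  fixes M :: "'w measure"
    and X :: "(real^'n) set"
    and f :: "real^'n \<Rightarrow> 'w \<Rightarrow> real"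
    and \<mu>0 :: "real^'n \<Rightarrow> real"
    and \<kappa> :: "real^'n \<Rightarrow> real^'n \<Rightarrow> real"
    and x :: "'k::finite \<Rightarrow> real^'n"
    and x_new y_new :: "real^'n"
    and fx :: "'w \<Rightarrow> real^'k"
    and U :: "'w \<Rightarrow> real^(unit + 'n)"
    and A :: "real^'k^(unit + 'n)"
    and K :: "real^'k^'k"
    and K0 :: "real^(unit + 'n)^(unit + 'n)"
  assumes gp: "gaussian_process M X f \<mu>0 \<kappa>"
    and x: "\<And>j. x j \<in> X"
    and x_new: "x_new \<in> X"
    and y_new: "y_new \<in> interior X"
    and interchange: "\<exists>\<epsilon>>0. \<forall>i. interchangeable_on {-\<epsilon><..<\<epsilon>} M (\<lambda>t. f (y_new + t *\<^sub>R axis i 1))"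
    and fx: "\<And>w. fx w = at_points x (\<lambda>u. f u w)"
    and U: "\<And>w. U w = value_and_gradient (\<lambda>u. f u w) x_new y_new"
    and A: "A = cross_covariance \<kappa> x x_new y_new"
    and K: "K = kernel_matrix \<kappa> x"
    and K0: "K0 = prior_covariance \<kappa> x_new y_new"
    and K_inv: "invertible K"
  shows
    "gaussian_posterior M fx U
       (\<lambda>z. value_and_gradient \<mu>0 x_new y_new + (A ** matrix_inv K) *v (z - at_points x \<mu>0))
       (\<lambda>z. K0 - A ** matrix_inv K ** transpose A) \<and>
     (\<forall>m S. gaussian_posterior M fx U m S \<longrightarrow>
       (AE w in M. m (fx w) = value_and_gradient \<mu>0 x_new y_new
          + (A ** matrix_inv K) *v (fx w - at_points x \<mu>0)) \<and>
       (\<mu>0 x_new = 0 \<and> gradient \<mu>0 y_new = 0 \<longrightarrow>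
          (AE w in M. m (fx w) = (A ** matrix_inv K) *v (fx w - at_points x \<mu>0))) \<and>
       (AE w in M. S (fx w) = K0 - A ** matrix_inv K ** transpose A))"
proof -
  define H1 where "H1 = affine_combinations X f"
  define H where "H = pointwise_limits M H1"
  have gf: "gaussian_family M X f \<mu>0 \<kappa>" using gp by (simp add: gaussian_process_def)
  interpret H1: gaussian_space M H1
    unfolding H1_def by (rule gaussian_space_affine_combinations[OF gf])
  interpret gaussian_space M H
    unfolding H_def by (rule H1.gaussian_space_pointwise_limits)
  have fH1: "f p \<in> H1" if "p \<in> X" for p
    unfolding H1_def by (rule affine_combinations_base[OF that])
  have fH: "f p \<in> H" if "p \<in> X" for p
    unfolding H_def by (rule subsetD[OF subset_pointwise_limits fH1[OF that]])
  note E_f = gaussian_family_expectation[OF gf]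
  note cov_f = gaussian_family_cov[OF gf]
  define e :: "'n \<Rightarrow> real^'n" where "e i = axis i 1" for i
  define D where "D i w = gradient (\<lambda>u. f u w) y_new $ i" for i w
  obtain \<epsilon> where \<epsilon>: "\<epsilon> > 0" "\<And>i. interchangeable_on {-\<epsilon><..<\<epsilon>} M (\<lambda>t. f (y_new + t *\<^sub>R e i))"
    using interchange unfolding e_def by blast
  \<comment> \<open>Since \<open>y_new\<close> is interior, a ball keeps all difference quotients
    inside \<open>X\<close>, where \<open>f\<close>, \<open>\<mu>0\<close> and
    \<open>\<kappa>\<close> are related.\<close>
  obtain \<delta> where \<delta>: "\<delta> > 0" "ball y_new \<delta> \<subseteq> X" using y_new by (auto simp: mem_interior)
  define T where "T = {-\<delta><..<\<delta>}"
  have T: "open T" "0 \<in> T" using \<delta> by (simp_all add: T_def)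
  have line: "y_new + t *\<^sub>R e i \<in> X" if "t \<in> T" for t i
    using that \<delta>(2) by (auto simp: T_def e_def dist_norm norm_axis_1 abs_less_iff intro!: subsetD[OF \<delta>(2)])
  have y: "y_new \<in> X" using \<delta> by auto
  \<comment> \<open>\<open>gradient\<close> is built on the total operator \<open>deriv\<close>;
    differentiability of the paths at 0 shows that its value is a genuine derivative.\<close>
  have D_deriv: "((\<lambda>t. f (y_new + t *\<^sub>R e i) w) has_real_derivative D i w) (at 0)" if w: "w \<in> space M" for i w
  proof -
    have "(\<lambda>t. f (y_new + t *\<^sub>R e i) w) C1_differentiable_on {-\<epsilon><..<\<epsilon>}"
      using \<epsilon>(2)[of i] w by (simp add: interchangeable_on_def)
    then obtain d where "((\<lambda>t. f (y_new + t *\<^sub>R e i) w) has_real_derivative d) (at 0)"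
      using \<epsilon>(1) unfolding C1_differentiable_on_def has_real_derivative_iff_has_vector_derivative by fastforce
    then show ?thesis using DERIV_imp_deriv by (fastforce simp: D_def gradient_def e_def)
  qed
  have DH: "D i \<in> H" for i
  proof -
    \<comment> \<open>The offset 2 keeps every step strictly below \<open>\<delta>\<close>; with 1
      the first step would be \<open>\<delta>\<close> itself, outside the open interval
      \<open>T\<close>.\<close>
    define h where "h n = \<delta> / real (n + 2)" for n
    have h: "h n \<in> T" "h n \<noteq> 0" for n 
    proof -
      have "0 < h n" using \<delta>(1) by (simp add: h_def)
      moreover have "h n < \<delta>"
        using divide_strict_left_mono[of 1 "real (n + 2)" \<delta>] \<delta>(1) by (simp add: h_def)
      ultimately show "h n \<in> T" "h n \<noteq> 0" by (simp_all add: T_def)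
    qed
    have h0: "h \<longlonglongrightarrow> 0" unfolding h_def by (rule LIMSEQ_ignore_initial_segment[OF lim_const_over_n])
    define W where "W n w = 1 / h n * (f (y_new + h n *\<^sub>R e i) w - f y_new w)" for n w
    have "W n \<in> H1" for n
      unfolding W_def[abs_def] by (intro H1.scale H1.diff fH1 line h y)
    moreover have "(\<lambda>n. W n w) \<longlonglongrightarrow> D i w" if "w \<in> space M" for w
      using D_deriv[OF that, of i] h h0
      unfolding has_field_derivative_iff tendsto_at_iff_sequentially by (simp add: W_def comp_def)
    ultimately show ?thesis unfolding H_def pointwise_limits_def by blast
  qed
  \<comment> \<open>Mean and kernel agree with moments of the process only on \<open>X\<close>, so
    the gradient of \<open>g\<close> is computed from a function \<open>g'\<close> that agrees with
    it along the coordinate line near 0.\<close>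
  have gradI: "gradient g y_new $ i = d"
    if "((\<lambda>t. g' t) has_real_derivative d) (at 0)" "\<And>t. t \<in> T \<Longrightarrow> g' t = g (y_new + t *\<^sub>R e i)" for g g' d i
    unfolding gradient_def e_def[symmetric]
    using DERIV_imp_deriv[OF has_field_derivative_transform_within_open[OF that(1) T that(2)]] by simp
  note lineH = fH[OF line]
  have grad_mean: "gradient \<mu>0 y_new $ i = integral\<^sup>L M (D i)" for i
  proof (rule gradI)
    show "((\<lambda>t. integral\<^sup>L M (f (y_new + t *\<^sub>R e i))) has_real_derivative integral\<^sup>L M (D i)) (at 0)"
      by (rule expectation_has_derivative[OF T]) (simp_all add: lineH DH D_deriv)
    show "integral\<^sup>L M (f (y_new + t *\<^sub>R e i)) = \<mu>0 (y_new + t *\<^sub>R e i)" if "t \<in> T" for t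
      by (rule E_f[OF line[OF that]])
  qed
  have grad_cov: "gradient g y_new $ i = cov M (D i) V"
    if "V \<in> H" "\<And>t. t \<in> T \<Longrightarrow> cov M (f (y_new + t *\<^sub>R e i)) V = g (y_new + t *\<^sub>R e i)" for g V i
  proof (rule gradI)
    show "((\<lambda>t. cov M (f (y_new + t *\<^sub>R e i)) V) has_real_derivative cov M (D i) V) (at 0)"
      by (rule cov_has_derivative[OF T]) (simp_all add: lineH DH D_deriv that(1))
  qed (rule that(2))
  have grad1: "gradient (\<lambda>u. \<kappa> u p) y_new $ i = cov M (D i) (f p)" if "p \<in> X" for p i
    by (rule grad_cov[OF fH[OF that]]) (simp add: cov_f line that)
  have grad2: "gradient (\<lambda>v. \<kappa> p v) y_new $ i = cov M (f p) (D i)" if "p \<in> X" for p i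
    unfolding cov_commute[of M "f p"]
    by (rule grad_cov[OF fH[OF that]]) (simp add: cov_f line that cov_commute[of M _ "f p"])
  \<comment> \<open>By \<open>grad2\<close> the inner gradient at a point \<open>u\<close> of the
    line is the covariance of \<open>f u\<close> with \<open>D j\<close>; with \<open>D j\<close>
    held fixed in \<open>H\<close>, the outer derivative moves \<open>f u\<close> alone.\<close>
  have grad12: "gradient (\<lambda>u. gradient (\<lambda>v. \<kappa> u v) y_new $ j) y_new $ i = cov M (D i) (D j)" for i j
    by (rule grad_cov[OF DH]) (simp add: grad2 line)
  have U_Inl: "(\<lambda>w. U w $ Inl a) = f x_new" and U_Inr: "(\<lambda>w. U w $ Inr i) = D i" for a i
    by (simp_all add: U value_and_gradient_def D_def[abs_def])
  have UH: "(\<lambda>w. U w $ r) \<in> H" for r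
    by (cases r) (simp_all add: U_Inl U_Inr DH fH x_new)
  have V_nth: "(\<lambda>w. fx w $ j) = f (x j)" for j by (simp add: fx at_points_def)
  have VH: "(\<lambda>w. fx w $ j) \<in> H" for j by (simp add: V_nth fH x)
  let ?m = "\<lambda>z. value_and_gradient \<mu>0 x_new y_new + (A ** matrix_inv K) *v (z - at_points x \<mu>0)"
  let ?S = "\<lambda>z::real^'k. K0 - A ** matrix_inv K ** transpose A"
  have post: "gaussian_posterior M fx U ?m ?S"
  proof (rule gaussian_conditioning[OF UH VH])
    show "K = (\<chi> i j. cov M (\<lambda>w. fx w $ i) (\<lambda>w. fx w $ j))"
      by (simp add: K kernel_matrix_def V_nth cov_f x)
    show "A = (\<chi> r j. cov M (\<lambda>w. U w $ r) (\<lambda>w. fx w $ j))"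
      by (simp add: A cross_covariance_def vec_eq_iff V_nth U_Inl U_Inr cov_f x x_new grad1 split: sum.split)
    show "K0 = (\<chi> r s. cov M (\<lambda>w. U w $ r) (\<lambda>w. U w $ s))"
      by (simp add: K0 prior_covariance_def vec_eq_iff U_Inl U_Inr cov_f x_new grad1 grad2 grad12 split: sum.split)
    show "value_and_gradient \<mu>0 x_new y_new = (\<chi> r. integral\<^sup>L M (\<lambda>w. U w $ r))"
      by (simp add: value_and_gradient_def vec_eq_iff U_Inl U_Inr E_f x_new grad_mean split: sum.split)
    show "at_points x \<mu>0 = (\<chi> j. integral\<^sup>L M (\<lambda>w. fx w $ j))"
      by (simp add: at_points_def V_nth E_f x)
  qed (rule K_inv)
  have fx_measurable: "fx \<in> borel_measurable M"
  proof (rule borel_measurable_vector)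
    show "(\<lambda>w. b \<bullet> fx w) \<in> H" for b
      unfolding inner_vec_def by (intro sum) (simp add: scale VH)
  qed
  have zero: "value_and_gradient \<mu>0 x_new y_new = 0" if "\<mu>0 x_new = 0" "gradient \<mu>0 y_new = 0"
    using that by (simp add: value_and_gradient_def vec_eq_iff split: sum.split)
  show ?thesis
  proof (intro conjI allI impI post)
    fix m S assume P: "gaussian_posterior M fx U m S"
    have AE: "AE w in M. m (fx w) = ?m (fx w) \<and> S (fx w) = ?S (fx w)"
      by (rule gaussian_posterior_unique[OF fx_measurable P post])
    then show "AE w in M. m (fx w) = ?m (fx w)" "AE w in M. S (fx w) = ?S (fx w)"
      by (auto elim: eventually_mono)
    assume "\<mu>0 x_new = 0 \<and> gradient \<mu>0 y_new = 0"
    then show "AE w in M. m (fx w) = (A ** matrix_inv K) *v (fx w - at_points x \<mu>0)"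
      using AE zero by (auto elim: eventually_mono)
  qed
qed

end
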